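(* Let $\{\mathcal{A}_n(x)\}_{n\ge0}$ be the scaled Atkin polynomials, let $C_n=\frac{1}{n+1}\binom{2n}{n}$ be the Catalan numbers, and let $C(x)$, $D(x)$ and $\delta=\delta(x,t)$ be as defined in the context. (1) For $0<x<1$ and $|t|<1$, $$\sum_{n=0}^\infty C_{n+1}\mathcal{A}_{n+1}(x)t^n=\frac{\delta^{17/12}}{x^{11/12}\sqrt{x-t\delta}}\,F\left(\tfrac{11}{12},\tfrac{19}{12};3;\tfrac{t\delta}{x}\right)\left[C(x)\,F\left(-\tfrac{7}{12},\tfrac{17}{12};\tfrac13;\delta\right)+D(x)\left(\tfrac{\delta}{x}\right)^{2/3}F\left(\tfrac{1}{12},\tfrac{25}{12};\tfrac53;\delta\right)\right].$$ (2) For $|t|<1$, $$\sum_{n=0}^\infty C_{n+1}\mathcal{A}_{n+1}(0)(-t)^n=-\frac{5}{12}\,F\left(\tfrac{11}{12},\tfrac{17}{12};3;t\right),$$ and consequently, for all integers $n\ge0$, $$\mathcal{A}_{n+1}(0)=(-1)^n\left(-\frac{5}{12}\right)\frac{\left(\frac{11}{12}\right)_n\left(\frac{17}{12}\right)_n}{(2n+1)!}.$$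
   Context: Scaled Atkin polynomials: $\mathcal{A}_0(x)=1$, $\mathcal{A}_1(x)=x-\frac{5}{12}$, $\mathcal{A}_2(x)=x^2-\frac{205}{216}x+\frac{935}{10368}$, and for $n>1$ $$\mathcal{A}_{n+1}(x)=\left[x-\frac{2(n^2-29/144)}{4n^2-1}\right]\mathcal{A}_n(x)-\frac{(n-\frac{13}{12})(n-\frac{7}{12})(n-\frac{5}{12})(n+\frac1{12})}{2n(2n-1)^2(2n-2)}\mathcal{A}_{n-1}(x).$$ (They are related to the Atkin polynomials $A_n$ by $A_n(1728y)=1728^n\mathcal{A}_n(y)$.) $F(a,b;d;z)={}_2F_1(a,b;d;z)$ is the Gauss hypergeometric function (principal branch on $\mathbb{C}\setminus[1,\infty)$) and $(a)_m=a(a+1)\cdots(a+m-1)$, $(a)_0=1$. For $0\le x<1$, $$C(x)=-\frac{1}{60}\left(24\,F\left(-\tfrac{5}{12},-\tfrac{5}{12};-\tfrac13;x\right)+F\left(-\tfrac{5}{12},-\tfrac{5}{12};\tfrac23;x\right)\right),$$ $$D(x)=\frac{91}{384}\,x\left(4\,F\left(-\tfrac{1}{12},-\tfrac{1}{12};\tfrac13;x\right)-5\,F\left(\tfrac{11}{12},-\tfrac{1}{12};\tfrac43;x\right)\right).$$ For $0<x<1$, $|t|<1$, $t\ne0$, $$\delta=\frac{(1+t)-\sqrt{(1+t)^2-4xt}}{2t},$$ with the square root being the branch analytic in $|t|<1$ that equals $1$ at $t=0$; at $t=0$ put $\delta=x$ (its limit). The fractional powers of $\delta$, $\delta/x$ and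 $x-t\delta$ are the branches analytic in $|t|<1$ which take positive values at $t=0$. *)

theory Defs
  imports "HOL-Complex_Analysis.Complex_Analysis"
    "HOL-Computational_Algebra.Polynomial"
begin

definition catalan :: "nat \<Rightarrow> real" where
  "catalan n = real ((2 * n) choose n) / real (n + 1)"

(* In the last equation the usual recursion index is n = k + 2; the recursion
   has a pole at n = 1, which is why the quadratic polynomial is given explicitly. *)
fun scaled_atkin :: "nat \<Rightarrow> real poly" where
  "scaled_atkin 0 = 1"
| "scaled_atkin (Suc 0) = [:- 5/12, 1:]"
| "scaled_atkin (Suc (Suc 0)) = [:935/10368, - 205/216, 1:]"
| "scaled_atkin (Suc (Suc (Suc k))) =
    (let n = real (k + 2) in
       [:- (2 * (n\<^sup>2 - 29/144) / (4 * n\<^sup>2 - 1)), 1:] * scaled_atkin (Suc (Suc k))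
       - smult ((n - 13/12) * (n - 7/12) * (n - 5/12) * (n + 1/12)
                 / (2 * n * (2 * n - 1)\<^sup>2 * (2 * n - 2)))
           (scaled_atkin (Suc k)))"

definition hyp2f1_series :: "complex \<Rightarrow> complex \<Rightarrow> complex \<Rightarrow> complex \<Rightarrow> complex" where
  "hyp2f1_series a b d z =
     (\<Sum>n. pochhammer a n * pochhammer b n / (pochhammer d n * fact n) * z ^ n)"

(* Principal branch: the Gauss series in the unit disc, and its analytic
   continuation to the complex plane cut along [1, \<infinity>) elsewhere. The continuation is
   unique by the identity theorem; on the cut itself the value is unspecified. *)
definition hyp2f1 :: "complex \<Rightarrow> complex \<Rightarrow> complex \<Rightarrow> complex \<Rightarrow> complex" where
  "hyp2f1 a b d z =
     (if norm z < 1 then hyp2f1_series a b d z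
      else (THE w. \<exists>f. f holomorphic_on (- (complex_of_real ` {1..})) \<and>
                       (\<forall>y. norm y < 1 \<longrightarrow> f y = hyp2f1_series a b d y) \<and> w = f z))"

(* g is an analytic branch of h to the power p on the open unit disc, i.e. exp (p L)
   for an analytic logarithm L of h, and it is positive at the origin. *)
definition is_power_branch :: "real \<Rightarrow> (complex \<Rightarrow> complex) \<Rightarrow> (complex \<Rightarrow> complex) \<Rightarrow> bool" where
  "is_power_branch p h g \<longleftrightarrow>
     (\<exists>L. L holomorphic_on ball 0 1 \<and>
          (\<forall>t\<in>ball 0 1. exp (L t) = h t \<and> g t = exp (complex_of_real p * L t))) \<and>
     (\<exists>r>0. g 0 = complex_of_real r)"

(* Two branches on the disc differ by a constant factor of modulus one, so
   positivity at the origin determines the values on the disc. *)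
definition power_branch :: "real \<Rightarrow> (complex \<Rightarrow> complex) \<Rightarrow> complex \<Rightarrow> complex" where
  "power_branch p h t = (THE w. \<exists>g. is_power_branch p h g \<and> w = g t)"

(* The radicand equals 1 at t = 0, so the branch positive there is the one with value 1. *)
definition atkin_delta :: "real \<Rightarrow> complex \<Rightarrow> complex" where
  "atkin_delta x t =
     (if t = 0 then complex_of_real x
      else ((1 + t) - power_branch (1/2) (\<lambda>s. (1 + s)\<^sup>2 - 4 * complex_of_real x * s) t) / (2 * t))"

definition atkin_C :: "real \<Rightarrow> complex" where
  "atkin_C x = - (1/60) *
     (24 * hyp2f1 (- 5/12) (- 5/12) (- 1/3) (complex_of_real x)
      + hyp2f1 (- 5/12) (- 5/12) (2/3) (complex_of_real x))"

definition atkin_D :: "real \<Rightarrow> complex" where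
  "atkin_D x = 91/384 * complex_of_real x *
     (4 * hyp2f1 (- 1/12) (- 1/12) (1/3) (complex_of_real x)
      - 5 * hyp2f1 (11/12) (- 1/12) (4/3) (complex_of_real x))"

end

theory Submission
  imports Defs
begin

text \<open>
  Fix \<open>x\<close> and put \<open>w = t \<delta> / x\<close>. Then \<open>\<delta> = x (1 - w) / (1 - x w)\<close> and \<open>t = w (1 - x w) / (1 - w)\<close>, so the right-hand side
  of (1) is a prefactor times \<open>f(w) g(\<delta>)\<close>, where \<open>f\<close> and \<open>g\<close> solve hypergeometric equations and \<open>\<delta>\<close> is a Moebius
  function of \<open>w\<close>. With \<open>\<theta> = t d/dt\<close> this product \<open>P\<close> has a companion \<open>Q\<close> such that, for \<open>R = Q - 2 (\<theta> + 1) P\<close>,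
  \<open>\<theta> (\<theta> + 2) P = t ((\<theta> + 17/12) (\<theta> + 25/12) P - (1 - x) (2 \<theta> + 3) Q)\<close> and
  \<open>\<theta> (\<theta> + 2) R = t (\<theta> + 19/12) (\<theta> + 11/12) Q\<close>.
  Eliminating \<open>Q\<close> from the Taylor coefficients gives exactly the three-term recurrence of \<open>C\<^bsub>n+1\<^esub> A\<^bsub>n+1\<^esub>(x)\<close>.
  The first two coefficients are Legendre-type relations: contiguity and Euler's transformation express \<open>C(x)\<close> and
  \<open>D(x)\<close> through the two hypergeometric functions at \<open>\<delta> = x\<close>, and the relations reduce to their Wronskian.
  Finally the right-hand side is analytic in \<open>\<bar>t\<bar> < 1\<close>, because there \<open>\<bar>\<delta>\<bar> < \<surd>x\<close> and \<open>w\<close> avoids the cut \<open>[1, \<infinity>)\<close>.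
\<close>

text \<open>A three-term recurrence leaves two starting values free. The bracket in (1) is the
  general solution of one hypergeometric equation:
  \<open>\<delta>^(2/3) F(1/12,25/12;5/3;\<delta>)\<close> is the second local solution at 0 of the
  equation of \<open>F(-7/12,17/12;1/3;\<delta>)\<close>. So the recurrence holds for any constants
  in place of \<open>C(x)\<close> and \<open>D(x)\<close>; their actual values fit coefficients 0
  and 1.

  The obstacle is analytic. \<open>\<delta>\<close> stays in the unit disc, so both series in
  \<open>\<delta>\<close> converge throughout, but \<open>w\<close> tends to
  \<open>-1/sqrt x\<close> as \<open>t\<close> tends to -1. Only \<open>F(11/12,19/12;3;w)\<close>
  needs its continuation. The differential equations are used only near 0, where
  \<open>\<bar>w\<bar> < 1\<close>; the result spreads because a function holomorphic on the disc is
  the sum of its Taylor series.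

  Most identities are cleared of denominators: 12 and 144 remove the twelfths, a factor
  \<open>1 - w\<close> trades \<open>t\<close> for \<open>w\<close>, and polynomial identities
  remain.

  In (2) the order is reversed: induction on the recursion gives the closed form, and the series
  follows termwise.\<close>

unbundle no vec_syntax

subsection \<open>The Gauss series\<close>

definition hyp_fps :: "complex \<Rightarrow> complex \<Rightarrow> complex \<Rightarrow> complex fps" where
  "hyp_fps a b c = Abs_fps (\<lambda>n. pochhammer a n * pochhammer b n / (pochhammer c n * fact n))"

lemma hyp_fps_nth: "fps_nth (hyp_fps a b c) n = pochhammer a n * pochhammer b n / (pochhammer c n * fact n)"
  by (simp add: hyp_fps_def)

lemma hyp_fps_0 [simp]: "fps_nth (hyp_fps a b c) 0 = 1"
  by (simp add: hyp_fps_nth)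

lemma hyp2f1_eq_eval_fps: "norm z < 1 \<Longrightarrow> hyp2f1 a b c z = eval_fps (hyp_fps a b c) z"
  by (simp add: hyp2f1_def hyp2f1_series_def eval_fps_def hyp_fps_nth)

lemma hyp_fps_Suc:
  assumes "c \<notin> \<int>\<^sub>\<le>\<^sub>0"
  shows "(c + of_nat n) * of_nat (Suc n) * fps_nth (hyp_fps a b c) (Suc n)
         = (a + of_nat n) * (b + of_nat n) * fps_nth (hyp_fps a b c) n"
proof -
  have "pochhammer c n \<noteq> 0" "c + of_nat n \<noteq> 0"
    using assms by (auto dest!: pochhammer_eq_0_imp_nonpos_Int plus_of_nat_eq_0_imp)
  moreover have "(1 + of_nat n :: complex) \<noteq> 0" by (metis of_nat_Suc of_nat_eq_0_iff nat.simps(3))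
  ultimately show ?thesis
    by (simp add: hyp_fps_nth pochhammer_Suc divide_simps)
qed

text \<open>The ratio of consecutive coefficients tends to 1. Keeping \<open>a\<close> and
  \<open>b\<close> off the nonpositive integers makes every coefficient nonzero; otherwise the
  series would be a polynomial.\<close>

lemma hyp_fps_conv_radius:
  assumes "a \<notin> \<int>\<^sub>\<le>\<^sub>0" "b \<notin> \<int>\<^sub>\<le>\<^sub>0" "c \<notin> \<int>\<^sub>\<le>\<^sub>0"
  shows "fps_conv_radius (hyp_fps a b c) = 1"
  unfolding fps_conv_radius_def
proof (rule conv_radius_ratio_limit_ereal)
  have nz: "fps_nth (hyp_fps a b c) n \<noteq> 0" for n
    using assms by (auto simp: hyp_fps_nth dest!: pochhammer_eq_0_imp_nonpos_Int)
  then show "\<forall>\<^sub>F n in sequentially. fps_nth (hyp_fps a b c) n \<noteq> 0" by simp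
  have lim1: "(\<lambda>n. (u + of_nat n) / (v + of_nat n)) \<longlonglongrightarrow> 1" if v: "v \<notin> \<int>\<^sub>\<le>\<^sub>0" for u v :: complex
  proof -
    have "(\<lambda>n. 1 + (u - v) / (v + of_nat n)) \<longlonglongrightarrow> 1 + 0"
      by (intro tendsto_intros tendsto_divide_0[OF tendsto_const] tendsto_add_filterlim_at_infinity[OF tendsto_const] tendsto_of_nat)
    moreover have "1 + (u - v) / (v + of_nat n) = (u + of_nat n) / (v + of_nat n)" for n
    proof -
      have "v + of_nat n \<noteq> 0" using v by (auto dest!: plus_of_nat_eq_0_imp)
      then show ?thesis by (simp add: field_simps)
    qed
    ultimately show ?thesis by simp
  qed
  have ratio: "fps_nth (hyp_fps a b c) n / fps_nth (hyp_fps a b c) (Suc n)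
      = ((c + of_nat n) / (a + of_nat n)) * ((1 + of_nat n) / (b + of_nat n))" for n
  proof -
    have "a + of_nat n \<noteq> 0" "b + of_nat n \<noteq> 0"
      using assms by (auto dest!: plus_of_nat_eq_0_imp)
    then show ?thesis using hyp_fps_Suc[OF assms(3), of n a b] nz[of "Suc n"]
      by (simp add: times_divide_times_eq frac_eq_eq mult_ac add_ac)
  qed
  have "(\<lambda>n. ((c + of_nat n) / (a + of_nat n)) * ((1 + of_nat n) / (b + of_nat n))) \<longlonglongrightarrow> 1 * 1"
    by (intro tendsto_mult lim1 assms)
  then have "(\<lambda>n. norm (fps_nth (hyp_fps a b c) n / fps_nth (hyp_fps a b c) (Suc n))) \<longlonglongrightarrow> norm (1 * 1 :: complex)"
    unfolding ratio by (rule tendsto_norm)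
  then show "(\<lambda>n. ereal (norm (fps_nth (hyp_fps a b c) n) / norm (fps_nth (hyp_fps a b c) (Suc n)))) \<longlonglongrightarrow> 1"
    by (simp add: norm_divide one_ereal_def)
qed

text \<open>Stated for an arbitrary series: read coefficientwise, the hypergeometric equation is the
  recurrence of \<open>hyp_fps_Suc\<close>, which serves both for the equation and for its
  uniqueness.\<close>

lemma hyp_ode_lhs_nth:
  fixes F :: "complex fps"
  shows "fps_nth (fps_X * (1 - fps_X) * fps_deriv (fps_deriv F)
            + (fps_const c - fps_const (a + b + 1) * fps_X) * fps_deriv F) n
         = (c + of_nat n) * of_nat (Suc n) * fps_nth F (Suc n)
            - ((a + of_nat n) * (b + of_nat n) - a * b) * fps_nth F n"
proof -
  have "fps_X * (1 - fps_X) * fps_deriv (fps_deriv F) + (fps_const c - fps_const (a + b + 1) * fps_X) * fps_deriv F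
        = fps_X * fps_deriv (fps_deriv F) - fps_X * (fps_X * fps_deriv (fps_deriv F)) + fps_const c * fps_deriv F
          - fps_const (a + b + 1) * (fps_X * fps_deriv F)"
    by (simp add: algebra_simps)
  then show ?thesis
    by (cases n rule: nat.exhaust; cases "n - 1" rule: nat.exhaust) (simp_all add: algebra_simps)
qed

text \<open>Because \<open>c + n\<close> never vanishes, the equation determines each coefficient
  from the previous one.\<close>

lemma hyp_fps_unique:
  assumes c: "c \<notin> \<int>\<^sub>\<le>\<^sub>0"
    and ode: "fps_X * (1 - fps_X) * fps_deriv (fps_deriv F) + (fps_const c - fps_const (a + b + 1) * fps_X) * fps_deriv F
              = fps_const (a * b) * F"
    and F0: "fps_nth F 0 = 1"
  shows "F = hyp_fps a b c"
proof -
  have rec: "(c + of_nat n) * of_nat (Suc n) * fps_nth F (Suc n) = (a + of_nat n) * (b + of_nat n) * fps_nth F n" for n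
    using arg_cong[OF ode, of "\<lambda>G. fps_nth G n"] hyp_ode_lhs_nth[of F c a b n]
    by (simp add: algebra_simps)
  have "fps_nth F n = fps_nth (hyp_fps a b c) n" for n
  proof (induction n)
    case (Suc n)
    have "c + of_nat n \<noteq> 0" using c by (auto dest!: plus_of_nat_eq_0_imp)
    moreover have "of_nat (Suc n) \<noteq> (0::complex)" by (metis of_nat_eq_0_iff nat.simps(3))
    ultimately show ?case using rec[of n] hyp_fps_Suc[OF c, of n a b] Suc
      by (metis mult_cancel_left mult_eq_0_iff)
  qed (simp add: F0)
  then show ?thesis by (simp add: fps_eq_iff)
qed

lemma hyp_fps_ode:
  assumes c: "c \<notin> \<int>\<^sub>\<le>\<^sub>0"
  shows "fps_X * (1 - fps_X) * fps_deriv (fps_deriv (hyp_fps a b c))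
          + (fps_const c - fps_const (a + b + 1) * fps_X) * fps_deriv (hyp_fps a b c)
          = fps_const (a * b) * hyp_fps a b c"
  using hyp_fps_Suc[OF c] by (intro fps_ext, subst hyp_ode_lhs_nth) (simp add: algebra_simps)

lemma hyp_eval_ode:
  assumes "a \<notin> \<int>\<^sub>\<le>\<^sub>0" "b \<notin> \<int>\<^sub>\<le>\<^sub>0" "c \<notin> \<int>\<^sub>\<le>\<^sub>0" and z: "norm z < 1"
  defines "F \<equiv> hyp_fps a b c"
  shows "z * (1 - z) * eval_fps (fps_deriv (fps_deriv F)) z
         = a * b * eval_fps F z - (c - (a + b + 1) * z) * eval_fps (fps_deriv F) z"
    and "(eval_fps F has_field_derivative eval_fps (fps_deriv F) z) (at z)"
    and "(eval_fps (fps_deriv F) has_field_derivative eval_fps (fps_deriv (fps_deriv F)) z) (at z)"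
proof -
  have R: "fps_conv_radius F \<ge> 1" "fps_conv_radius (fps_deriv F) \<ge> 1" "fps_conv_radius (fps_deriv (fps_deriv F)) \<ge> 1"
    using hyp_fps_conv_radius[OF assms(1-3)] fps_conv_radius_deriv[of F] fps_conv_radius_deriv[of "fps_deriv F"]
    by (auto simp: F_def)
  have z': "ereal (norm z) < 1" using z by simp
  have ok: "ereal (norm z) < fps_conv_radius F" "ereal (norm z) < fps_conv_radius (fps_deriv F)" "ereal (norm z) < fps_conv_radius (fps_deriv (fps_deriv F))"
    using R z' by (meson less_le_trans)+
  have okm: "ereal (norm z) < fps_conv_radius (A * B)" if "ereal (norm z) < fps_conv_radius A" "ereal (norm z) < fps_conv_radius B" for A B :: "complex fps"
    using that fps_conv_radius_mult[of A B] by (meson less_le_trans min_less_iff_conj)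
  have okp: "ereal (norm z) < fps_conv_radius (A + B)" if "ereal (norm z) < fps_conv_radius A" "ereal (norm z) < fps_conv_radius B" for A B :: "complex fps"
    using that fps_conv_radius_add[of A B] by (meson less_le_trans min_less_iff_conj)
  have okd: "ereal (norm z) < fps_conv_radius (A - B)" if "ereal (norm z) < fps_conv_radius A" "ereal (norm z) < fps_conv_radius B" for A B :: "complex fps"
    using that fps_conv_radius_diff[of A B] by (meson less_le_trans min_less_iff_conj)
  have "eval_fps (fps_X * (1 - fps_X) * fps_deriv (fps_deriv F) + (fps_const c - fps_const (a + b + 1) * fps_X) * fps_deriv F) z
     = eval_fps (fps_const (a * b) * F) z"
    unfolding F_def hyp_fps_ode[OF assms(3)] ..
  then show "z * (1 - z) * eval_fps (fps_deriv (fps_deriv F)) z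
         = a * b * eval_fps F z - (c - (a + b + 1) * z) * eval_fps (fps_deriv F) z"
    using ok by (simp add: eval_fps_add eval_fps_diff eval_fps_mult okm okp okd eq_diff_eq del: fps_const_add)
  show "(eval_fps F has_field_derivative eval_fps (fps_deriv F) z) (at z)"
    using ok by (intro has_field_derivative_eval_fps) auto
  show "(eval_fps (fps_deriv F) has_field_derivative eval_fps (fps_deriv (fps_deriv F)) z) (at z)"
    using ok by (intro has_field_derivative_eval_fps) auto
qed

lemma sums_hyp2f1:
  assumes "a \<notin> \<int>\<^sub>\<le>\<^sub>0" "b \<notin> \<int>\<^sub>\<le>\<^sub>0" "c \<notin> \<int>\<^sub>\<le>\<^sub>0" "norm t < 1"
  shows "(\<lambda>n. pochhammer a n * pochhammer b n / (pochhammer c n * fact n) * t ^ n) sums hyp2f1 a b c t"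
proof -
  have "(\<lambda>n. fps_nth (hyp_fps a b c) n * t ^ n) sums eval_fps (hyp_fps a b c) t"
    by (rule sums_eval_fps) (use assms hyp_fps_conv_radius in simp)
  then show ?thesis using assms(4) by (simp add: hyp2f1_eq_eval_fps hyp_fps_nth)
qed

subsection \<open>Legendre relations for \<open>C(x)\<close> and \<open>D(x)\<close>\<close>

text \<open>All parameters are multiples of 1/12, so the question reduces to an integer
  congruence.\<close>

lemma twelfths_not_nonpos_Int:
  fixes z :: complex
  assumes "12 * z = of_int k" "k mod 12 \<noteq> 0 \<or> k > 0"
  shows "z \<notin> \<int>\<^sub>\<le>\<^sub>0"
proof
  assume "z \<in> \<int>\<^sub>\<le>\<^sub>0"
  then obtain n where "n \<le> 0" "z = of_int n" by (auto simp: nonpos_Ints_def)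
  with assms(1) have "of_int (12 * n) = (of_int k :: complex)" by simp
  then have "12 * n = k" by (simp only: of_int_eq_iff)
  with assms(2) \<open>n \<le> 0\<close> show False by auto
qed

lemma params_not_nonpos_Int:
  "- 5/12 \<notin> (\<int>\<^sub>\<le>\<^sub>0 :: complex set)"
  "- 1/3 \<notin> (\<int>\<^sub>\<le>\<^sub>0 :: complex set)"
  "2/3 \<notin> (\<int>\<^sub>\<le>\<^sub>0 :: complex set)"
  "- 1/12 \<notin> (\<int>\<^sub>\<le>\<^sub>0 :: complex set)"
  "1/3 \<notin> (\<int>\<^sub>\<le>\<^sub>0 :: complex set)"
  "11/12 \<notin> (\<int>\<^sub>\<le>\<^sub>0 :: complex set)"
  "4/3 \<notin> (\<int>\<^sub>\<le>\<^sub>0 :: complex set)"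
  "- 7/12 \<notin> (\<int>\<^sub>\<le>\<^sub>0 :: complex set)"
  "17/12 \<notin> (\<int>\<^sub>\<le>\<^sub>0 :: complex set)"
  "1/12 \<notin> (\<int>\<^sub>\<le>\<^sub>0 :: complex set)"
  "25/12 \<notin> (\<int>\<^sub>\<le>\<^sub>0 :: complex set)"
  "5/3 \<notin> (\<int>\<^sub>\<le>\<^sub>0 :: complex set)"
  "19/12 \<notin> (\<int>\<^sub>\<le>\<^sub>0 :: complex set)"
  "3 \<notin> (\<int>\<^sub>\<le>\<^sub>0 :: complex set)"
proof -
  show "- 5/12 \<notin> (\<int>\<^sub>\<le>\<^sub>0 :: complex set)" by (rule twelfths_not_nonpos_Int[of _ "-5"]) simp_all
  show "- 1/3 \<notin> (\<int>\<^sub>\<le>\<^sub>0 :: complex set)" by (rule twelfths_not_nonpos_Int[of _ "-4"]) simp_all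
  show "2/3 \<notin> (\<int>\<^sub>\<le>\<^sub>0 :: complex set)" by (rule twelfths_not_nonpos_Int[of _ "8"]) simp_all
  show "- 1/12 \<notin> (\<int>\<^sub>\<le>\<^sub>0 :: complex set)" by (rule twelfths_not_nonpos_Int[of _ "-1"]) simp_all
  show "1/3 \<notin> (\<int>\<^sub>\<le>\<^sub>0 :: complex set)" by (rule twelfths_not_nonpos_Int[of _ "4"]) simp_all
  show "11/12 \<notin> (\<int>\<^sub>\<le>\<^sub>0 :: complex set)" by (rule twelfths_not_nonpos_Int[of _ "11"]) simp_all
  show "4/3 \<notin> (\<int>\<^sub>\<le>\<^sub>0 :: complex set)" by (rule twelfths_not_nonpos_Int[of _ "16"]) simp_all
  show "- 7/12 \<notin> (\<int>\<^sub>\<le>\<^sub>0 :: complex set)" by (rule twelfths_not_nonpos_Int[of _ "-7"]) simp_all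
  show "17/12 \<notin> (\<int>\<^sub>\<le>\<^sub>0 :: complex set)" by (rule twelfths_not_nonpos_Int[of _ "17"]) simp_all
  show "1/12 \<notin> (\<int>\<^sub>\<le>\<^sub>0 :: complex set)" by (rule twelfths_not_nonpos_Int[of _ "1"]) simp_all
  show "25/12 \<notin> (\<int>\<^sub>\<le>\<^sub>0 :: complex set)" by (rule twelfths_not_nonpos_Int[of _ "25"]) simp_all
  show "5/3 \<notin> (\<int>\<^sub>\<le>\<^sub>0 :: complex set)" by (rule twelfths_not_nonpos_Int[of _ "20"]) simp_all
  show "19/12 \<notin> (\<int>\<^sub>\<le>\<^sub>0 :: complex set)" by (rule twelfths_not_nonpos_Int[of _ "19"]) simp_all
  show "3 \<notin> (\<int>\<^sub>\<le>\<^sub>0 :: complex set)" by (rule twelfths_not_nonpos_Int[of _ "36"]) simp_all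
qed

section \<open>Euler's transformation and the Wronskian\<close>

text \<open>\<open>S\<close> is \<open>(1 - X)^(a + b - c)\<close>, specified by its first-order
  equation. The product solves the equation with parameters \<open>c - a\<close>,
  \<open>c - b\<close>, \<open>c\<close>, and \<open>hyp_fps_unique\<close> identifies it.\<close>

lemma hyp_fps_euler:
  fixes S :: "complex fps"
  assumes c: "c \<notin> \<int>\<^sub>\<le>\<^sub>0" and S0: "fps_nth S 0 = 1"
    and S: "(1 - fps_X) * fps_deriv S = - (fps_const (a + b - c) * S)"
  shows "S * hyp_fps a b c = hyp_fps (c - a) (c - b) c"
proof (rule hyp_fps_unique[OF c])
  define F where "F = hyp_fps a b c"
  define A B K where "A = fps_const a" "B = fps_const b" "K = fps_const c"
  have h1: "(1 - fps_X) * fps_deriv S = - ((A + B - K) * S)"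
    using S by (simp add: A_B_K_def)
  have "fps_deriv ((1 - fps_X) * fps_deriv S) = fps_deriv (- ((A + B - K) * S))"
    by (simp add: h1)
  then have h2: "(1 - fps_X) * fps_deriv (fps_deriv S) - fps_deriv S = - ((A + B - K) * fps_deriv S)"
    by (simp add: A_B_K_def algebra_simps)
  have h3: "fps_X * (1 - fps_X) * fps_deriv (fps_deriv F) + (K - (A + B + 1) * fps_X) * fps_deriv F = A * B * F"
    using hyp_fps_ode[OF c, of a b] by (simp add: F_def A_B_K_def flip: fps_const_add)
  \<comment> \<open>One extra factor \<open>1 - X\<close>: \<open>h2\<close> trades the second
    derivative of \<open>S\<close> for the first, and \<open>h1\<close> removes the first only
    against another \<open>1 - X\<close>.\<close>
  have "(1 - fps_X) * (fps_X * (1 - fps_X) * (fps_deriv (fps_deriv S) * F + 2 * (fps_deriv S * fps_deriv F) + S * fps_deriv (fps_deriv F))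
        + (K - (2 * K - A - B + 1) * fps_X) * (fps_deriv S * F + S * fps_deriv F))
       = (1 - fps_X) * ((K - A) * (K - B) * (S * F))"
    using h1 h2 h3 by algebra
  moreover have "(1 - fps_X :: complex fps) \<noteq> 0"
    by (metis fps_X_neq_one right_minus_eq)
  ultimately have "fps_X * (1 - fps_X) * (fps_deriv (fps_deriv S) * F + 2 * (fps_deriv S * fps_deriv F) + S * fps_deriv (fps_deriv F))
        + (K - (2 * K - A - B + 1) * fps_X) * (fps_deriv S * F + S * fps_deriv F)
       = (K - A) * (K - B) * (S * F)"
    by (simp only: mult_cancel_left) simp
  moreover have "fps_const (c - a + (c - b) + 1) = 2 * K - A - B + 1"
    by (simp add: A_B_K_def numeral_fps_const flip: fps_const_add fps_const_sub fps_const_mult fps_const_1_eq_1)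
  moreover have "fps_const ((c - a) * (c - b)) = (K - A) * (K - B)"
    by (simp add: A_B_K_def)
  moreover have "fps_deriv (fps_deriv (S * F)) = fps_deriv (fps_deriv S) * F + 2 * (fps_deriv S * fps_deriv F) + S * fps_deriv (fps_deriv F)"
    by (simp add: algebra_simps)
  moreover have "fps_deriv (S * F) = fps_deriv S * F + S * fps_deriv F" by (simp add: algebra_simps)
  ultimately show "fps_X * (1 - fps_X) * fps_deriv (fps_deriv (S * hyp_fps a b c))
     + (fps_const c - fps_const (c - a + (c - b) + 1) * fps_X) * fps_deriv (S * hyp_fps a b c)
     = fps_const ((c - a) * (c - b)) * (S * hyp_fps a b c)"
    by (simp only: F_def A_B_K_def)
qed (simp add: S0)

lemma fps_sqrt_one_minus_X:
  obtains S :: "complex fps" where "S * S = 1 - fps_X" "fps_nth S 0 = 1"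
proof
  define S :: "complex fps" where "S = fps_binomial (1/2) oo (- fps_X)"
  have "S * S = (fps_binomial (1/2) * fps_binomial (1/2)) oo (- fps_X)"
    by (simp add: S_def fps_compose_mult_distrib)
  also have "\<dots> = (1 + fps_X) oo (- fps_X)"
    by (simp add: fps_binomial_add_mult[symmetric] fps_binomial_1)
  also have "\<dots> = 1 - fps_X" by (simp add: fps_compose_add_distrib)
  finally show "S * S = 1 - fps_X" .
  show "fps_nth S 0 = 1" by (simp add: S_def)
qed


text \<open>Abel's formula. \<open>X^(2/3) z\<close> is the second solution of the equation of
  \<open>y\<close>, and the combination in the second claim is \<open>3 X^(1/3)\<close> times their
  Wronskian, hence a multiple of \<open>(1 - X)^(-3/2)\<close>, that is of \<open>S^(-3)\<close>.
  The constant 2 is the value at 0.\<close>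

lemma atkin_hyp_wronskian:
  fixes S :: "complex fps"
  assumes S: "S * S = 1 - fps_X" and S0: "fps_nth S 0 = 1"
  defines "y \<equiv> hyp_fps (- 7/12) (17/12) (1/3)" and "z \<equiv> hyp_fps (1/12) (25/12) (5/3)"
  shows "2 * (S * fps_deriv S) = - 1"
    and "S * S * S * ((2 * z + 3 * (fps_X * fps_deriv z)) * y - 3 * (fps_X * fps_deriv y * z)) = 2"
proof -
  have nz: "(1 - fps_X :: complex fps) \<noteq> 0" 
    by (metis fps_X_neq_one right_minus_eq)
  have "fps_deriv (S * S) = fps_deriv (1 - fps_X)" by (simp add: S)
  then show dS: "2 * (S * fps_deriv S) = - 1" by (simp add: algebra_simps)
  note c = params_not_nonpos_Int(5,12)
  \<comment> \<open>Scaling by 144 turns the fractional constants into numerals, which ring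
    normalisation can combine.\<close>
  have nums: "144 * fps_const (1/3) = (48 :: complex fps)" "144 * fps_const (11/6) = (264 :: complex fps)"
     "144 * fps_const (5/3) = (240 :: complex fps)" "144 * fps_const (19/6) = (456 :: complex fps)"
     "144 * (fps_const (- (119/144)) * y) = - 119 * y" "144 * (fps_const (25/144) * z) = 25 * z"
    by (simp_all add: numeral_fps_const flip: mult.assoc)
  have "144 * (fps_X * (1 - fps_X) * fps_deriv (fps_deriv y) + (fps_const (1/3) - fps_const (11/6) * fps_X) * fps_deriv y)
     = 144 * (fps_const (- (119/144)) * y)"
    using hyp_fps_ode[OF c(1), of "- 7/12" "17/12"] by (simp add: y_def)
  also have "144 * (fps_X * (1 - fps_X) * fps_deriv (fps_deriv y) + (fps_const (1/3) - fps_const (11/6) * fps_X) * fps_deriv y)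
     = 144 * (fps_X * (1 - fps_X) * fps_deriv (fps_deriv y)) + (144 * fps_const (1/3) - 144 * fps_const (11/6) * fps_X) * fps_deriv y"
    by (simp add: algebra_simps)
  finally have y: "144 * (fps_X * (1 - fps_X) * fps_deriv (fps_deriv y)) = - 119 * y - (48 - 264 * fps_X) * fps_deriv y"
    unfolding nums by (simp add: eq_diff_eq)
  have "144 * (fps_X * (1 - fps_X) * fps_deriv (fps_deriv z) + (fps_const (5/3) - fps_const (19/6) * fps_X) * fps_deriv z)
     = 144 * (fps_const (25/144) * z)"
    using hyp_fps_ode[OF c(2), of "1/12" "25/12"] by (simp add: z_def)
  also have "144 * (fps_X * (1 - fps_X) * fps_deriv (fps_deriv z) + (fps_const (5/3) - fps_const (19/6) * fps_X) * fps_deriv z)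
     = 144 * (fps_X * (1 - fps_X) * fps_deriv (fps_deriv z)) + (144 * fps_const (5/3) - 144 * fps_const (19/6) * fps_X) * fps_deriv z"
    by (simp add: algebra_simps)
  finally have z: "144 * (fps_X * (1 - fps_X) * fps_deriv (fps_deriv z)) = 25 * z - (240 - 456 * fps_X) * fps_deriv z"
    unfolding nums by (simp add: eq_diff_eq)
  define W where "W = (2 * z + 3 * (fps_X * fps_deriv z)) * y - 3 * (fps_X * fps_deriv y * z)"
  have dW: "fps_deriv W = (5 * fps_deriv z + 3 * (fps_X * fps_deriv (fps_deriv z))) * y
      - (fps_deriv y + 3 * (fps_X * fps_deriv (fps_deriv y))) * z"
    by (simp add: W_def algebra_simps)
  have "144 * ((1 - fps_X) * fps_deriv W)
     = (720 * (1 - fps_X) * fps_deriv z + 3 * (144 * (fps_X * (1 - fps_X) * fps_deriv (fps_deriv z)))) * y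
      - (144 * (1 - fps_X) * fps_deriv y + 3 * (144 * (fps_X * (1 - fps_X) * fps_deriv (fps_deriv y)))) * z"
    unfolding dW by (simp add: algebra_simps)
  also have "\<dots> = 216 * W" unfolding y z W_def by (simp add: algebra_simps)
  finally have "72 * (2 * ((1 - fps_X) * fps_deriv W)) = 72 * (3 * W)" by simp
  then have eW: "2 * ((1 - fps_X) * fps_deriv W) = 3 * W"
    by (simp only: mult_cancel_left) simp
  have "2 * (1 - fps_X) * (3 * S * fps_deriv S * W + S * S * fps_deriv W)
      = 3 * (1 - fps_X) * W * (2 * (S * fps_deriv S)) + S * S * (2 * ((1 - fps_X) * fps_deriv W))"
    by (simp add: algebra_simps)
  also have "\<dots> = 0" unfolding dS eW S by (simp add: algebra_simps)
  finally have "3 * S * fps_deriv S * W + S * S * fps_deriv W = 0" using nz by simp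
  moreover have "fps_deriv (S * S * S * W) = S * (3 * S * fps_deriv S * W + S * S * fps_deriv W)"
    by (simp add: algebra_simps)
  ultimately have "fps_deriv (S * S * S * W) = 0" by simp
  then obtain w where w: "S * S * S * W = fps_const w"
    by (metis fps_deriv_eq_0_iff)
  have "w = fps_nth (S * S * S * W) 0" by (simp add: w)
  also have "\<dots> = 2" by (simp add: S0 W_def y_def z_def)
  finally show "S * S * S * ((2 * z + 3 * (fps_X * fps_deriv z)) * y - 3 * (fps_X * fps_deriv y * z)) = 2"
    using w by (simp add: W_def numeral_fps_const)
qed

section \<open>Contiguity relations, coefficient by coefficient\<close>

lemma eq_quotient_mult:
  fixes k :: "'a :: field"
  shows "k * a = l * b \<Longrightarrow> k \<noteq> 0 \<Longrightarrow> a = l / k * b"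
  by (simp add: nonzero_eq_divide_eq mult.commute)

lemma hyp_fps_Suc_twelfths:
  assumes c: "c \<notin> \<int>\<^sub>\<le>\<^sub>0" and A: "12 * a = A" and B: "12 * b = B" and K: "12 * c = K"
  shows "(12 * of_nat n + K) * (of_nat n + 1) * 12 * hyp_fps a b c $ Suc n
         = (12 * of_nat n + A) * (12 * of_nat n + B) * hyp_fps a b c $ n"
proof -
  have "(12 * of_nat n + K) * (of_nat n + 1) * 12 * hyp_fps a b c $ Suc n
     = 144 * ((c + of_nat n) * of_nat (Suc n) * hyp_fps a b c $ Suc n)"
    unfolding K[symmetric] by (simp add: algebra_simps)
  also have "\<dots> = (12 * of_nat n + A) * (12 * of_nat n + B) * hyp_fps a b c $ n"
    unfolding hyp_fps_Suc[OF c] A[symmetric] B[symmetric] by (simp add: algebra_simps)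
  finally show ?thesis .
qed

lemma twelfths_nonzero:
  "k mod 12 \<noteq> 0 \<Longrightarrow> 12 * of_nat n + (of_int k :: complex) \<noteq> 0"
proof
  assume k: "k mod 12 \<noteq> 0" and "12 * of_nat n + (of_int k :: complex) = 0"
  then have "of_int (12 * int n + k) = (0 :: complex)" by simp
  then have "12 * int n + k = 0" by (simp only: of_int_eq_0_iff)
  with k show False by presburger
qed

text \<open>The left side evaluates to \<open>- 120 * C(x)\<close>, and by Euler's transformation
  \<open>u\<close> will be \<open>S * z\<close>. The coefficients of both series on the left are
  rational multiples of those of \<open>u\<close>, so the claim is a rational identity in
  \<open>n\<close>.\<close>

lemma atkin_C_contiguous:
  defines "u \<equiv> hyp_fps (19/12) (- 5/12) (5/3)"
  shows "48 * hyp_fps (- 5/12) (- 5/12) (- 1/3) + 2 * hyp_fps (- 5/12) (- 5/12) (2/3)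
    = (1 - fps_X) * ((75 * fps_X + 50) * u - fps_X * (180 * fps_X - 75) * fps_deriv u)"
proof -
  define p where "p = hyp_fps (- 5/12) (- 5/12) (- 1/3)"
  define r where "r = hyp_fps (- 5/12) (- 5/12) (2/3)"
  note c = params_not_nonpos_Int(2,3,12)
  have nz: "12 * of_nat n - 4 \<noteq> (0::complex)" "12 * of_nat n + 8 \<noteq> (0::complex)" "12 * of_nat n + 20 \<noteq> (0::complex)"
     "12 * of_nat n + 19 \<noteq> (0::complex)" "12 * of_nat n + 31 \<noteq> (0::complex)" "12 * of_nat n + 32 \<noteq> (0::complex)" 
     "of_nat n + 1 \<noteq> (0::complex)" "of_nat n + 2 \<noteq> (0::complex)" for n
    using twelfths_nonzero[of "-4" n] twelfths_nonzero[of 8 n] twelfths_nonzero[of 20 n] twelfths_nonzero[of 19 n]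
      twelfths_nonzero[of 31 n] twelfths_nonzero[of 32 n] of_nat_neq_0[of n, where 'a = complex] of_nat_neq_0[of "Suc n", where 'a = complex]
    by (simp_all add: add.commute)
  have u_Suc: "(12 * of_nat n + 20) * (of_nat n + 1) * 12 * u $ Suc n = (12 * of_nat n + 19) * (12 * of_nat n - 5) * u $ n" for n
    using hyp_fps_Suc_twelfths[OF c(3), of "19/12" 19 "- 5/12" "-5" 20 n] by (simp add: u_def)
  have r_Suc: "(12 * of_nat n + 8) * (of_nat n + 1) * 12 * r $ Suc n = (12 * of_nat n - 5) * (12 * of_nat n - 5) * r $ n" for n
    using hyp_fps_Suc_twelfths[OF c(2), of "- 5/12" "-5" "- 5/12" "-5" 8 n] by (simp add: r_def)
  have p_Suc: "(12 * of_nat n - 4) * (of_nat n + 1) * 12 * p $ Suc n = (12 * of_nat n - 5) * (12 * of_nat n - 5) * p $ n" for n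
    using hyp_fps_Suc_twelfths[OF c(1), of "- 5/12" "-5" "- 5/12" "-5" "-4" n] by (simp add: p_def)
  \<comment> \<open>The lower parameters \<open>- 1/3\<close> and \<open>2/3\<close> differ by 1, so
    the quotient of Pochhammer symbols telescopes.\<close>
  have pr: "p $ n = (1 - 3 * of_nat n) * r $ n" for n
  proof (induction n)
    case (Suc n)
    let ?k = "(12 * of_nat n - 4) * (of_nat n + 1) * (12 :: complex)"
    have "?k * p $ Suc n = (1 - 3 * of_nat n) * ((12 * of_nat n - 5) * (12 * of_nat n - 5) * r $ n)"
      unfolding p_Suc Suc by (simp only: mult_ac)
    also have "\<dots> = ?k * ((1 - 3 * of_nat (Suc n)) * r $ Suc n)"
      unfolding r_Suc[symmetric] by (simp add: algebra_simps)
    finally show ?case using nz(1)[of n] nz(7)[of n] by (simp only: mult_cancel_left) simp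
  qed (simp add: p_def r_def)
  \<comment> \<open>Shifting an upper parameter by 2 and the lower one by 1 costs a quadratic and a
    linear factor.\<close>
  have ru: "2 * (12 * of_nat n - 5) * (12 * of_nat n + 7) * r $ n = - 35 * (3 * of_nat n + 2) * u $ n" for n
  proof (induction n)
    case (Suc n)
    let ?N = "of_nat n :: complex"
    let ?k = "(12 * ?N + 8) * (?N + 1) * 12"
    have "?k * (2 * (12 * of_nat (Suc n) - 5) * (12 * of_nat (Suc n) + 7) * r $ Suc n)
       = 2 * (12 * ?N + 7) * (12 * ?N + 19) * (?k * r $ Suc n)" by (simp add: algebra_simps)
    also have "\<dots> = (12 * ?N + 19) * (12 * ?N - 5) * (2 * (12 * of_nat n - 5) * (12 * of_nat n + 7) * r $ n)"
      unfolding r_Suc by (simp only: mult_ac)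
    also have "\<dots> = - 35 * (3 * ?N + 2) * ((12 * ?N + 19) * (12 * ?N - 5) * u $ n)"
      unfolding Suc by (simp only: mult_ac)
    also have "\<dots> = ?k * (- 35 * (3 * of_nat (Suc n) + 2) * u $ Suc n)"
      unfolding u_Suc[symmetric] by (simp add: algebra_simps)
    finally show ?case using nz(2)[of n] nz(7)[of n] by (simp only: mult_cancel_left) simp
  qed (simp add: u_def r_def)
  have "48 * p $ n + 2 * r $ n = ((1 - fps_X) * ((75 * fps_X + 50) * u - fps_X * (180 * fps_X - 75) * fps_deriv u)) $ n" for n
  proof -
    have e: "(1 - fps_X) * ((75 * fps_X + 50) * u - fps_X * (180 * fps_X - 75) * fps_deriv u)
      = 50 * u + 75 * (fps_X * fps_deriv u) + 25 * (fps_X * u) - 255 * (fps_X * (fps_X * fps_deriv u))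
         - 75 * (fps_X * (fps_X * u)) + 180 * (fps_X * (fps_X * (fps_X * fps_deriv u)))"
      by (simp add: algebra_simps)
    \<comment> \<open>The right side reaches down to the coefficient of index
      \<open>n - 2\<close>.\<close>
    consider "n = 0" | "n = 1" | m where "n = Suc (Suc m)" by (metis One_nat_def not0_implies_Suc)
    then show ?thesis
    proof cases
      case 1 then show ?thesis unfolding e by (simp add: p_def r_def u_def numeral_fps_const)
    next
      case 2 then show ?thesis unfolding e
        by (simp add: p_def r_def u_def numeral_fps_const hyp_fps_nth)
    next
      case (3 m)
      define M where "M = (of_nat m :: complex)"
      note nz' = nz[of m, folded M_def]
      have u1: "u $ Suc m = (12 * M + 19) * (12 * M - 5) / ((12 * M + 20) * (M + 1) * 12) * u $ m"
        by (rule eq_quotient_mult) (use u_Suc[of m] nz' in \<open>simp_all add: M_def\<close>)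
      have "(12 * M + 32) * (M + 2) * 12 * u $ Suc (Suc m) = (12 * M + 31) * (12 * M + 7) * u $ Suc m"
        using u_Suc[of "Suc m"] by (simp add: M_def algebra_simps)
      then have u2: "u $ Suc (Suc m) = (12 * M + 31) * (12 * M + 7) / ((12 * M + 32) * (M + 2) * 12) * u $ Suc m"
        by (rule eq_quotient_mult) (use nz' in \<open>simp del: distrib_left_numeral distrib_right_numeral\<close>)
      have "(2 * (12 * M + 19) * (12 * M + 31)) * r $ n = - 35 * (3 * M + 8) * u $ n"
        using ru[of n] 3 by (simp add: M_def algebra_simps)
      then have rn: "r $ n = - 35 * (3 * M + 8) / (2 * (12 * M + 19) * (12 * M + 31)) * u $ n"
        by (rule eq_quotient_mult) (use nz' in \<open>simp del: distrib_left_numeral distrib_right_numeral\<close>)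
      have "48 * p $ n + 2 * r $ n = (50 - 144 * (M + 2)) * r $ n"
        unfolding pr using 3 by (simp add: M_def algebra_simps)
      also have "\<dots> = (50 + 75 * (M + 2)) * u $ Suc (Suc m) + (25 - 255 * (M + 1)) * u $ Suc m + (180 * M - 75) * u $ m"
        unfolding 3 rn[unfolded 3] u2 u1 using nz' by (simp add: divide_simps del: distrib_left_numeral distrib_right_numeral) (simp add: algebra_simps)
      also have "\<dots> = ((1 - fps_X) * ((75 * fps_X + 50) * u - fps_X * (180 * fps_X - 75) * fps_deriv u)) $ n"
        unfolding e 3 by (cases m; simp add: numeral_fps_const M_def algebra_simps)
      finally show ?thesis .
    qed
  qed
  then show ?thesis
    by (intro fps_ext) (simp add: p_def r_def numeral_fps_const)
qed


text \<open>The counterpart for \<open>D(x)\<close>: \<open>X\<close> times the left side evaluates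
  to \<open>384 * D(x)\<close>, and \<open>v\<close> will be \<open>S * y\<close>.\<close>

lemma atkin_D_contiguous:
  defines "v \<equiv> hyp_fps (11/12) (- 13/12) (1/3)"
  shows "91 * (4 * hyp_fps (- 1/12) (- 1/12) (1/3) - 5 * hyp_fps (11/12) (- 1/12) (4/3))
    = (1 - fps_X) * (624 * v - (576 * fps_X - 240) * fps_deriv v)"
proof -
  define p where "p = hyp_fps (- 1/12) (- 1/12) (1/3)"
  define r where "r = hyp_fps (11/12) (- 1/12) (4/3)"
  note c = params_not_nonpos_Int(5,7)
  have nz: "12 * of_nat n + 4 \<noteq> (0::complex)" "12 * of_nat n + 16 \<noteq> (0::complex)" 
     "12 * of_nat n + 11 \<noteq> (0::complex)" 
     "of_nat n + 1 \<noteq> (0::complex)" "of_nat n + 2 \<noteq> (0::complex)" for n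
    using twelfths_nonzero[of 4 n] twelfths_nonzero[of 16 n] twelfths_nonzero[of 11 n]
      of_nat_neq_0[of n, where 'a = complex] of_nat_neq_0[of "Suc n", where 'a = complex]
    by (simp_all add: add.commute)
  have v_Suc: "(12 * of_nat n + 4) * (of_nat n + 1) * 12 * v $ Suc n = (12 * of_nat n + 11) * (12 * of_nat n - 13) * v $ n" for n
    using hyp_fps_Suc_twelfths[OF c(1), of "11/12" 11 "- 13/12" "-13" 4 n] by (simp add: v_def)
  have r_Suc: "(12 * of_nat n + 16) * (of_nat n + 1) * 12 * r $ Suc n = (12 * of_nat n + 11) * (12 * of_nat n - 1) * r $ n" for n
    using hyp_fps_Suc_twelfths[OF c(2), of "11/12" "11" "- 1/12" "-1" 16 n] by (simp add: r_def)
  have p_Suc: "(12 * of_nat n + 4) * (of_nat n + 1) * 12 * p $ Suc n = (12 * of_nat n - 1) * (12 * of_nat n - 1) * p $ n" for n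
    using hyp_fps_Suc_twelfths[OF c(1), of "- 1/12" "-1" "- 1/12" "-1" "4" n] by (simp add: p_def)
  have pv: "13 * (12 * of_nat n - 1) * p $ n = (12 * of_nat n - 13) * v $ n" for n
  proof (induction n)
    case (Suc n)
    let ?N = "of_nat n :: complex"
    let ?k = "(12 * ?N + 4) * (?N + 1) * 12"
    have "?k * (13 * (12 * of_nat (Suc n) - 1) * p $ Suc n) = 13 * (12 * ?N + 11) * (?k * p $ Suc n)"
      by (simp add: algebra_simps)
    also have "\<dots> = (12 * ?N + 11) * (12 * ?N - 1) * (13 * (12 * ?N - 1) * p $ n)"
      unfolding p_Suc by (simp only: mult_ac)
    also have "\<dots> = (12 * ?N - 1) * ((12 * ?N + 11) * (12 * ?N - 13) * v $ n)"
      unfolding Suc by (simp only: mult_ac)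
    also have "\<dots> = ?k * ((12 * of_nat (Suc n) - 13) * v $ Suc n)"
      unfolding v_Suc[symmetric] by (simp add: algebra_simps)
    finally show ?case using nz(1)[of n] nz(4)[of n] by (simp only: mult_cancel_left) simp
  qed (simp add: p_def v_def)
  have rv: "13 * (3 * of_nat n + 1) * r $ n = - (12 * of_nat n - 13) * v $ n" for n
  proof (induction n)
    case (Suc n)
    let ?N = "of_nat n :: complex"
    let ?k = "(12 * ?N + 4) * (?N + 1) * 12"
    have "?k * (13 * (3 * of_nat (Suc n) + 1) * r $ Suc n) = 13 * (3 * ?N + 1) * ((12 * ?N + 16) * (?N + 1) * 12 * r $ Suc n)"
      by (simp add: algebra_simps)
    also have "\<dots> = (12 * ?N + 11) * (12 * ?N - 1) * (13 * (3 * ?N + 1) * r $ n)"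
      unfolding r_Suc by (simp only: mult_ac)
    also have "\<dots> = - (12 * ?N - 1) * ((12 * ?N + 11) * (12 * ?N - 13) * v $ n)"
      unfolding Suc by (simp add: algebra_simps)
    also have "\<dots> = ?k * (- (12 * of_nat (Suc n) - 13) * v $ Suc n)"
      unfolding v_Suc[symmetric] by (simp add: algebra_simps)
    finally show ?case using nz(1)[of n] nz(4)[of n] by (simp only: mult_cancel_left) simp
  qed (simp add: r_def v_def)
  have "91 * (4 * p $ n - 5 * r $ n) = ((1 - fps_X) * (624 * v - (576 * fps_X - 240) * fps_deriv v)) $ n" for n
  proof -
    have e: "(1 - fps_X) * (624 * v - (576 * fps_X - 240) * fps_deriv v)
      = 624 * v + 240 * fps_deriv v - 816 * (fps_X * fps_deriv v) - 624 * (fps_X * v) + 576 * (fps_X * (fps_X * fps_deriv v))"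
      by (simp add: algebra_simps)
    consider "n = 0" | m where "n = Suc m" by (metis not0_implies_Suc)
    then show ?thesis
    proof cases
      case 1 then show ?thesis unfolding e by (simp add: p_def r_def v_def numeral_fps_const hyp_fps_nth)
    next
      case (2 m)
      define M where "M = (of_nat m :: complex)"
      note nz' = nz[of m, folded M_def]
      have v1: "v $ Suc m = (12 * M + 11) * (12 * M - 13) / ((12 * M + 4) * (M + 1) * 12) * v $ m"
        by (rule eq_quotient_mult) (use v_Suc[of m] nz' in \<open>simp_all add: M_def\<close>)
      have "(12 * M + 16) * (M + 2) * 12 * v $ Suc (Suc m) = (12 * M + 23) * (12 * M - 1) * v $ Suc m"
        using v_Suc[of "Suc m"] by (simp add: M_def algebra_simps)
      then have v2: "v $ Suc (Suc m) = (12 * M + 23) * (12 * M - 1) / ((12 * M + 16) * (M + 2) * 12) * v $ Suc m"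
        by (rule eq_quotient_mult) (use nz' in \<open>simp del: distrib_left_numeral distrib_right_numeral\<close>)
      have "(13 * (12 * M + 11)) * p $ n = (12 * M - 1) * v $ n"
        using pv[of n] 2 by (simp add: M_def algebra_simps)
      then have pn: "p $ n = (12 * M - 1) / (13 * (12 * M + 11)) * v $ n"
        by (rule eq_quotient_mult) (use nz' in \<open>simp del: distrib_left_numeral distrib_right_numeral\<close>)
      have "(13 * (12 * M + 16)) * r $ n = (- 4 * (12 * M - 1)) * v $ n"
        using arg_cong[OF rv[of n], of "\<lambda>a. 4 * a"] 2 by (simp add: M_def algebra_simps)
      then have rn: "r $ n = (- 4 * (12 * M - 1)) / (13 * (12 * M + 16)) * v $ n"
        by (rule eq_quotient_mult) (use nz' in \<open>simp del: distrib_left_numeral distrib_right_numeral\<close>)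
      have "91 * (4 * p $ n - 5 * r $ n)
        = (624 - 816 * (M + 1)) * v $ Suc m + 240 * (M + 2) * v $ Suc (Suc m) + (576 * M - 624) * v $ m"
        unfolding 2 pn[unfolded 2] rn[unfolded 2] v2 v1 using nz' by (simp add: divide_simps del: distrib_left_numeral distrib_right_numeral) (simp add: algebra_simps)
      also have "\<dots> = ((1 - fps_X) * (624 * v - (576 * fps_X - 240) * fps_deriv v)) $ n"
        unfolding e 2 by (cases m; simp add: numeral_fps_const M_def algebra_simps)
      finally show ?thesis .
    qed
  qed
  then show ?thesis
    by (intro fps_ext) (simp add: p_def r_def numeral_fps_const)
qed

text \<open>Contiguity makes \<open>c\<close> linear in \<open>S z\<close> and its derivative,
  \<open>d\<close> linear in \<open>S y\<close> and its derivative. In both combinations everything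
  except a polynomial multiple of the Wronskian cancels, and the Wronskian is known.\<close>

lemma atkin_CD_fps:
  defines "y \<equiv> hyp_fps (- 7/12) (17/12) (1/3)" and "z \<equiv> hyp_fps (1/12) (25/12) (5/3)"
    and "c \<equiv> 48 * hyp_fps (- 5/12) (- 5/12) (- 1/3) + 2 * hyp_fps (- 5/12) (- 5/12) (2/3)"
    and "d \<equiv> 91 * (4 * hyp_fps (- 1/12) (- 1/12) (1/3) - 5 * hyp_fps (11/12) (- 1/12) (4/3))"
  shows "5 * (fps_X * d * z) - 16 * (c * y) = 160 * (12 * fps_X - 5)"
    and "(1 - fps_X) * (5 * (fps_X * d) * (3 * (fps_X * fps_deriv z) + 2 * z) - 48 * (c * (fps_X * fps_deriv y)))
         = fps_X * (5040 - 3360 * fps_X)"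
proof -
  obtain S :: "complex fps" where S: "S * S = 1 - fps_X" and S0: "fps_nth S 0 = 1"
    using fps_sqrt_one_minus_X by blast
  note W = atkin_hyp_wronskian[OF S S0, folded y_def z_def]
  have nz: "(1 - fps_X :: complex fps) \<noteq> 0" 
    by (metis fps_X_neq_one right_minus_eq)
  then have nS: "S \<noteq> 0" using S by auto
  have "2 * ((1 - fps_X) * fps_deriv S) = S * (2 * (S * fps_deriv S))"
    unfolding S[symmetric] by (simp only: mult_ac)
  also have "\<dots> = 2 * (- (fps_const (1/2) * S))"
    unfolding W(1) by (simp add: numeral_fps_const flip: mult.assoc)
  finally have dS: "(1 - fps_X) * fps_deriv S = - (fps_const (1/2) * S)"
    by (simp only: mult_cancel_left) simp
  note nonpos = params_not_nonpos_Int(5,12)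
  have u: "hyp_fps (19/12) (- 5/12) (5/3) = S * z"
    using hyp_fps_euler[OF nonpos(2) S0, of "1/12" "25/12"] dS by (simp add: z_def)
  have v: "hyp_fps (11/12) (- 13/12) (1/3) = S * y"
    using hyp_fps_euler[OF nonpos(1) S0, of "- 7/12" "17/12"] dS by (simp add: y_def)
  define X S' y' z' where "X = (fps_X :: complex fps)" and "S' = fps_deriv S" and "y' = fps_deriv y" and "z' = fps_deriv z"
  note folds = X_def[symmetric] S'_def[symmetric] y'_def[symmetric] z'_def[symmetric]
  have c: "c = (1 - X) * ((75 * X + 50) * (S * z) - X * (180 * X - 75) * (S' * z + S * z'))"
    unfolding c_def atkin_C_contiguous u by (simp add: folds algebra_simps)
  have d: "d = (1 - X) * (624 * (S * y) - (576 * X - 240) * (S' * y + S * y'))"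
    unfolding d_def atkin_D_contiguous v by (simp add: folds algebra_simps)
  note h = W[unfolded folds] S[unfolded folds]
  \<comment> \<open>After multiplication by \<open>2 * S\<close> the root occurs only in
    \<open>S * S = 1 - X\<close> and \<open>2 * (S * S') = - 1\<close>, so it disappears.\<close>
  have cS: "2 * S * c = (1 - X) * ((150 * X + 100) * ((S * S) * z) - X * (180 * X - 75) * ((2 * (S * S')) * z + 2 * (S * S) * z'))"
    unfolding c by (simp add: algebra_simps)
  have dS: "2 * S * d = (1 - X) * (1248 * ((S * S) * y) - (576 * X - 240) * ((2 * (S * S')) * y + 2 * (S * S) * y'))"
    unfolding d by (simp add: algebra_simps)
  define w where "w = (2 * z + 3 * (X * z')) * y - 3 * (X * y' * z)"
  have "S * S * (S * S * w) = 2 * S" using arg_cong[OF h(2), of "\<lambda>a. S * a"] by (simp add: w_def mult_ac)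
  then have w: "(1 - X) * (1 - X) * w = 2 * S" unfolding h(3) by (simp add: mult_ac)
  have "2 * S * (5 * (X * d * z) - 16 * (c * y)) = 5 * (X * (2 * S * d) * z) - 16 * ((2 * S * c) * y)"
    by (simp only: algebra_simps)
  also have "\<dots> = 160 * (12 * X - 5) * ((1 - X) * (1 - X) * w)"
    unfolding cS dS h(1,3) w_def by (simp add: algebra_simps)
  also have "\<dots> = 2 * S * (160 * (12 * X - 5))" unfolding w by (simp only: mult_ac)
  finally have "5 * (X * d * z) - 16 * (c * y) = 160 * (12 * X - 5)"
    using nS by (simp only: mult_cancel_left) simp
  then show "5 * (fps_X * d * z) - 16 * (c * y) = 160 * (12 * fps_X - 5)" by (simp add: X_def)
  have "2 * S * ((1 - X) * (5 * (X * d) * (3 * (X * z') + 2 * z) - 48 * (c * (X * y'))))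
      = (1 - X) * (5 * (X * (2 * S * d)) * (3 * (X * z') + 2 * z) - 48 * ((2 * S * c) * (X * y')))"
    by (simp only: algebra_simps)
  also have "\<dots> = X * (5040 - 3360 * X) * ((1 - X) * (1 - X) * w)"
    unfolding cS dS h(1,3) w_def by (simp add: algebra_simps)
  also have "\<dots> = 2 * S * (X * (5040 - 3360 * X))" unfolding w by (simp only: mult_ac)
  finally have "(1 - X) * (5 * (X * d) * (3 * (X * z') + 2 * z) - 48 * (c * (X * y'))) = X * (5040 - 3360 * X)"
    using nS by (simp only: mult_cancel_left) simp
  then show "(1 - fps_X) * (5 * (fps_X * d) * (3 * (fps_X * fps_deriv z) + 2 * z) - 48 * (c * (fps_X * fps_deriv y)))
         = fps_X * (5040 - 3360 * fps_X)" by (simp add: X_def y'_def z'_def)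
qed

subsection \<open>Analytic continuation to the cut plane\<close>

abbreviation cut_plane :: "complex set" where
  "cut_plane \<equiv> - (complex_of_real ` {1..})"

lemma mem_cut_plane_iff: "z \<in> cut_plane \<longleftrightarrow> Im z \<noteq> 0 \<or> Re z < 1"
  by (auto simp: image_iff complex_eq_iff not_le)

lemma open_cut_plane: "open cut_plane"
proof -
  have "cut_plane = {z. Im z \<noteq> 0} \<union> {z. Re z < 1}"
    using mem_cut_plane_iff by blast
  also have "open \<dots>"
    by (intro open_Un open_Collect_neq open_Collect_less continuous_intros)
  finally show ?thesis .
qed

lemma connected_cut_plane: "connected cut_plane"
proof -
  have "starlike cut_plane"
    unfolding starlike_def
  proof (intro bexI ballI subsetI)
    show "0 \<in> cut_plane" by (subst mem_cut_plane_iff) simp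
    fix z w assume z: "z \<in> cut_plane" and "w \<in> closed_segment 0 z"
    then obtain u where u: "0 \<le> u" "u \<le> 1" "w = u *\<^sub>R z" by (auto simp: in_segment)
    show "w \<in> cut_plane"
    proof (cases "Im z = 0")
      case True
      then have "Re z < 1" using z mem_cut_plane_iff by auto
      then have "u * Re z < 1" using u(1,2)
        by (smt (verit) mult_left_le_one_le mult_nonneg_nonpos mult.commute mult_left_le)
      then show ?thesis by (subst mem_cut_plane_iff) (simp add: u)
    next
      case False
      then show ?thesis using u by (subst mem_cut_plane_iff) (cases "u = 0"; simp)
    qed
  qed
  then show ?thesis by (rule starlike_imp_connected)
qed

lemma ball_subset_cut_plane: "ball 0 1 \<subseteq> cut_plane"
proof
  fix z :: complex assume "z \<in> ball 0 1"
  then have "Re z < 1" using complex_Re_le_cmod[of z] by (simp add: dist_norm)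
  then show "z \<in> cut_plane" by (subst mem_cut_plane_iff) simp
qed

text \<open>By the identity theorem on the connected cut plane, any one continuation of the Gauss
  series evaluates the definite description.\<close>

lemma hyp2f1_eq_continuation:
  assumes f: "f holomorphic_on cut_plane"
    and ser: "\<And>y. norm y < 1 \<Longrightarrow> f y = hyp2f1_series a b c y"
    and z: "z \<in> cut_plane"
  shows "hyp2f1 a b c z = f z"
proof (cases "norm z < 1")
  case False
  have "(THE w. \<exists>f. f holomorphic_on cut_plane \<and>
            (\<forall>y. norm y < 1 \<longrightarrow> f y = hyp2f1_series a b c y) \<and> w = f z) = f z"
  proof (rule the_equality)
    fix w assume "\<exists>f. f holomorphic_on cut_plane \<and>
            (\<forall>y. norm y < 1 \<longrightarrow> f y = hyp2f1_series a b c y) \<and> w = f z"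
    then obtain g where g: "g holomorphic_on cut_plane"
      "\<And>y. norm y < 1 \<Longrightarrow> g y = hyp2f1_series a b c y" "w = g z" by blast
    have "g z = f z"
      by (rule analytic_continuation_open[of "ball 0 1" cut_plane])
         (use open_cut_plane connected_cut_plane ball_subset_cut_plane f g ser z in auto)
    then show "w = f z" using g by simp
  qed (use f ser in blast)
  then show ?thesis using False by (simp add: hyp2f1_def)
qed (simp add: hyp2f1_def ser)

section \<open>Euler's integral and its termwise expansion\<close>

text \<open>These moments of the Euler kernel turn a binomial series into a Gauss series.\<close>

lemma Beta_shift_real:
  assumes "b > 0" "c > b"
  shows "Beta (b + real n) (c - b) = Beta b (c - b) * (pochhammer b n / pochhammer c n)"
proof (induction n)
  case (Suc n)
  have bn: "b + real n \<notin> \<int>\<^sub>\<le>\<^sub>0" using assms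
    by (metis add_pos_nonneg nonpos_Ints_nonpos not_le of_nat_0_le_iff)
  have cn: "c + real n > 0" using assms by simp
  have "(b + real n + (c - b)) * Beta (b + real n + 1) (c - b) = (b + real n) * Beta (b + real n) (c - b)"
    by (rule Beta_plus1_left[OF bn])
  then have "Beta (b + real (Suc n)) (c - b) = (b + real n) / (c + real n) * Beta (b + real n) (c - b)"
    using cn by (intro eq_quotient_mult) (simp_all add: add_ac)
  then show ?case unfolding Suc by (simp add: pochhammer_Suc mult_ac)
qed simp

lemma gbinomial_minus_mult_power:
  fixes a w :: complex
  shows "((- a) gchoose n) * (- w) ^ n = pochhammer a n / fact n * w ^ n"
  by (cases "even n") (simp_all add: gbinomial_pochhammer)

text \<open>Euler's integral; the bounds on \<open>b\<close> and \<open>c\<close> make its integrand continuous up to the end points.\<close>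

lemma hyp2f1_continuation:
  fixes a :: complex and b c :: real
  assumes b: "b > 1" and c: "c - b > 1"
  obtains f where "f holomorphic_on cut_plane"
    "\<And>y. norm y < 1 \<Longrightarrow> f y = hyp2f1_series a (of_real b) (of_real c) y"
proof
  define \<rho> where "\<rho> = (\<lambda>s::real. complex_of_real (s powr (b - 1) * (1 - s) powr (c - b - 1)))"
  define f where "f = (\<lambda>z. integral (cbox 0 1) (\<lambda>s. \<rho> s * (1 - z * of_real s) powr (- a)) / complex_of_real (Beta b (c - b)))"
  have \<rho>_cont: "continuous_on (cbox 0 1) \<rho>"
    unfolding \<rho>_def using b c by (intro continuous_intros continuous_on_powr') auto
  have powr_cont: "continuous_on (- \<real>\<^sub>\<le>\<^sub>0) (\<lambda>w::complex. w powr d)" for d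
    by (intro holomorphic_on_imp_continuous_on holomorphic_intros) auto
  \<comment> \<open>The segment from 1 to \<open>1 - z\<close> avoids the branch cut of
    \<open>powr\<close> exactly because \<open>z\<close> is off the cut.\<close>
  have cut: "1 - z * of_real s \<notin> \<real>\<^sub>\<le>\<^sub>0" if z: "z \<in> cut_plane" and s: "s \<in> cbox 0 1" for z s
  proof
    assume "1 - z * of_real s \<in> \<real>\<^sub>\<le>\<^sub>0"
    then have 1: "Re z * s \<ge> 1" "Im z * s = 0" by (auto simp: complex_nonpos_Reals_iff)
    then have "s \<noteq> 0" by auto
    then have "Im z = 0" using 1 by simp
    then have "Re z < 1" using z mem_cut_plane_iff by auto
    moreover have "0 < s" "s \<le> 1" using s \<open>s \<noteq> 0\<close> by auto
    ultimately have "Re z * s < 1"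
      by (smt (verit) mult_less_cancel_right2 mult_nonneg_nonpos2)
    with 1 show False by simp
  qed
  show "f holomorphic_on cut_plane"
  proof (subst holomorphic_on_open[OF open_cut_plane], intro ballI)
    fix z assume z: "z \<in> cut_plane"
    then obtain r where r: "r > 0" "ball z r \<subseteq> cut_plane"
      using open_cut_plane openE by blast
    have "(\<lambda>z. integral (cbox 0 1) (\<lambda>s. \<rho> s * (1 - z * of_real s) powr (- a))) holomorphic_on ball z r"
    proof (rule leibniz_rule_holomorphic[where fx = "\<lambda>z s. \<rho> s * (a * of_real s * (1 - z * of_real s) powr (- a - 1))"])
      fix x :: complex and t :: real assume xt: "x \<in> ball z r" "t \<in> cbox 0 1"
      then have "1 - x * of_real t \<notin> \<real>\<^sub>\<le>\<^sub>0" using cut r by blast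
      then have "((\<lambda>x. (1 - x * of_real t) powr (- a)) has_field_derivative (- a * (1 - x * of_real t) powr (- a - 1)) * (- of_real t)) (at x within ball z r)"
        by (intro DERIV_chain2[OF has_field_derivative_powr]) (auto intro!: derivative_eq_intros)
      from DERIV_cmult[OF this, of "\<rho> t"] show "((\<lambda>x. \<rho> t * (1 - x * of_real t) powr (- a)) has_field_derivative \<rho> t * (a * of_real t * (1 - x * of_real t) powr (- a - 1))) (at x within ball z r)"
        by (simp add: mult_ac)
    next
      fix x assume x: "x \<in> ball z r"
      have "continuous_on (cbox 0 1) (\<lambda>s. \<rho> s * (1 - x * of_real s) powr (- a))"
      proof (intro continuous_on_mult \<rho>_cont continuous_on_compose2[OF powr_cont])
        show "(\<lambda>s. 1 - x * complex_of_real s) ` cbox 0 1 \<subseteq> - \<real>\<^sub>\<le>\<^sub>0" using cut x r by blast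
      qed (intro continuous_intros)
      then show "(\<lambda>s. \<rho> s * (1 - x * of_real s) powr (- a)) integrable_on cbox 0 1"
        by (rule integrable_continuous)
    next
      show "continuous_on (ball z r \<times> cbox 0 1) (\<lambda>(z, s). \<rho> s * (a * of_real s * (1 - z * of_real s) powr (- a - 1)))"
        unfolding case_prod_unfold
      proof (intro continuous_on_mult continuous_on_const continuous_on_of_real continuous_on_compose2[OF powr_cont]
          continuous_on_compose2[OF \<rho>_cont] continuous_on_snd continuous_on_id)
        show "(\<lambda>p. 1 - fst p * complex_of_real (snd p)) ` (ball z r \<times> cbox 0 1) \<subseteq> - \<real>\<^sub>\<le>\<^sub>0"
          using cut r by auto
      qed (intro continuous_intros | force)+
    qed auto
    then have "f holomorphic_on ball z r"
      unfolding f_def using Beta_shift_real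
      by (intro holomorphic_intros) (use b c in \<open>auto simp: Beta_def Gamma_eq_zero_iff dest: nonpos_Ints_nonpos\<close>)
    then show "\<exists>f'. (f has_field_derivative f') (at z)"
      using r(1) holomorphic_on_open[of "ball z r" f] by auto
  qed
  fix y :: complex assume y: "norm y < 1"
  define M where "M = Beta b (c - b)"
  have M: "M \<noteq> 0" using b c by (auto simp: M_def Beta_def Gamma_eq_zero_iff dest: nonpos_Ints_nonpos)
  define T where "T = (\<lambda>n s. \<rho> s * (pochhammer a n / fact n * (y * of_real s) ^ n))"
  have Tsums: "(\<lambda>n. T n s) sums (\<rho> s * (1 - y * of_real s) powr (- a))" if s: "s \<in> {0..1}" for s
  proof -
    have "norm (- (y * of_real s)) \<le> norm y" using s by (simp add: norm_mult mult_left_le)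
    then have "(\<lambda>n. ((- a) gchoose n) * (- (y * of_real s)) ^ n) sums (1 + - (y * of_real s)) powr (- a)"
      using y by (intro gen_binomial_complex) simp
    moreover have "((- a) gchoose n) * (- (y * of_real s)) ^ n = pochhammer a n / fact n * (y * of_real s) ^ n" for n
      by (rule gbinomial_minus_mult_power)
    ultimately show ?thesis unfolding T_def by (intro sums_mult) simp
  qed
  have \<rho>_le: "norm (\<rho> s) \<le> 1" if "s \<in> {0..1}" for s
    using that b c by (auto simp: \<rho>_def norm_mult intro!: mult_le_one powr_le1)
  \<comment> \<open>Convergence at a radius strictly between \<open>norm y\<close> and 1 gives the
    absolute convergence that the M-test uses.\<close>
  have sm: "summable (\<lambda>n. norm (pochhammer a n / fact n * y ^ n))"
  proof -
    define r where "r = (1 + norm y) / 2"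
    have r: "norm y < r" "r < 1" "0 \<le> r" using y by (auto simp: r_def field_simps)
    have "0 \<le> r" using r(1) norm_ge_zero[of y] by linarith
    then have "norm (- (complex_of_real r)) < 1" using r by simp
    then have "summable (\<lambda>n. ((- a) gchoose n) * (- of_real r :: complex) ^ n)"
      using gen_binomial_complex sums_summable by blast
    moreover have "((- a) gchoose n) * (- of_real r :: complex) ^ n = pochhammer a n / fact n * of_real r ^ n" for n
      by (rule gbinomial_minus_mult_power)
    ultimately have "summable (\<lambda>n. pochhammer a n / fact n * (of_real r :: complex) ^ n)" by simp
    then show ?thesis by (rule powser_insidea) (use r norm_ge_zero[of y] in auto)
  qed
  have unif: "uniform_limit {0..1} (\<lambda>n s. \<Sum>i<n. T i s) (\<lambda>s. \<Sum>i. T i s) sequentially"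
  proof (rule Weierstrass_m_test[OF _ sm])
    fix n and s :: real assume s: "s \<in> {0..1}"
    have "norm (T n s) = norm (\<rho> s) * (norm (pochhammer a n / fact n * y ^ n) * s ^ n)"
      using s by (simp add: T_def norm_mult norm_power norm_divide power_mult_distrib)
    also have "\<dots> \<le> 1 * (norm (pochhammer a n / fact n * y ^ n) * 1)"
      using s \<rho>_le[OF s] by (intro mult_mono mult_left_mono power_le_one) auto
    finally show "norm (T n s) \<le> norm (pochhammer a n / fact n * y ^ n)" by simp
  qed
  have Tcont: "continuous_on {0..1} (\<lambda>s. \<Sum>i<n. T i s)" for n
    using \<rho>_cont unfolding T_def by (intro continuous_intros) auto
  obtain I J where IJ: "\<And>n. ((\<lambda>s. \<Sum>i<n. T i s) has_integral I n) {0..1}"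
    "((\<lambda>s. \<Sum>i. T i s) has_integral J) {0..1}" "I \<longlonglongrightarrow> J"
    using uniform_limit_integral[OF unif Tcont] by auto
  define h where "h = (\<lambda>i. pochhammer a i * pochhammer (of_real b) i / (pochhammer (of_real c) i * fact i) * y ^ i)"
  have Tint: "(T i has_integral (of_real M * h i)) {0..1}" for i
  proof -
    have "((\<lambda>t. t powr (b + real i - 1) * (1 - t) powr (c - b - 1)) has_integral Beta (b + real i) (c - b)) {0..1}"
      using b c by (intro has_integral_Beta_real) auto
    then have "((\<lambda>t. complex_of_real (t powr (b + real i - 1) * (1 - t) powr (c - b - 1))) has_integral complex_of_real (Beta (b + real i) (c - b))) {0..1}"
      by (rule has_integral_of_real)
    then have "((\<lambda>t. pochhammer a i / fact i * y ^ i * complex_of_real (t powr (b + real i - 1) * (1 - t) powr (c - b - 1)))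
       has_integral pochhammer a i / fact i * y ^ i * complex_of_real (Beta (b + real i) (c - b))) {0..1}"
      by (rule has_integral_mult_right)
    moreover have "pochhammer a i / fact i * y ^ i * complex_of_real (Beta (b + real i) (c - b)) = of_real M * h i"
      using b c by (simp add: Beta_shift_real h_def M_def pochhammer_of_real mult_ac)
    moreover have "pochhammer a i / fact i * y ^ i * complex_of_real (t powr (b + real i - 1) * (1 - t) powr (c - b - 1)) = T i t"
      if "t \<in> {0..1}" for t
    proof (cases "t = 0")
      \<comment> \<open>Both sides are 0 here, since \<open>0 powr\<close> any exponent is
        0.\<close>
      case True then show ?thesis using b by (simp add: T_def \<rho>_def)
    next
      case False
      then have "t powr (b + real i - 1) = t powr (b - 1) * t ^ i"
        using that by (simp add: powr_add powr_realpow add_diff_eq diff_add_eq[symmetric])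
      then show ?thesis by (simp add: T_def \<rho>_def power_mult_distrib mult_ac)
    qed
    ultimately show ?thesis by (metis (no_types, lifting) has_integral_cong)
  qed
  have "I = (\<lambda>n. \<Sum>i<n. of_real M * h i)"
    by (intro ext has_integral_unique[OF IJ(1)] has_integral_sum Tint) simp
  then have "(\<lambda>i. of_real M * h i) sums J" using IJ(3) by (simp add: sums_def)
  then have "(\<lambda>i. of_real M * h i / of_real M) sums (J / of_real M)" by (rule sums_divide)
  then have "h sums (J / of_real M)" using M by simp
  then have "hyp2f1_series a (of_real b) (of_real c) y = J / of_real M"
    by (simp add: hyp2f1_series_def h_def sums_iff)
  moreover have "((\<lambda>s. \<rho> s * (1 - y * of_real s) powr (- a)) has_integral J) {0..1}"
    by (rule has_integral_eq[OF _ IJ(2)]) (use Tsums in \<open>auto simp: sums_iff\<close>)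
  then have "f y = J / of_real M"
    by (simp add: f_def M_def cbox_interval integral_unique)
  ultimately show "f y = hyp2f1_series a (of_real b) (of_real c) y" by simp
qed

subsection \<open>The operator \<open>\<theta>\<close> and the generating function\<close>

text \<open>Taylor coefficients at 0 turn \<open>\<theta> = t d/dt\<close> into multiplication by the index.\<close>

definition has_theta :: "(complex \<Rightarrow> complex) \<Rightarrow> complex \<Rightarrow> complex \<Rightarrow> bool" where
  "has_theta F G t \<longleftrightarrow> (\<exists>D. (F has_field_derivative D) (at t) \<and> t * D = G)"

lemma has_thetaI: "(F has_field_derivative D) (at t) \<Longrightarrow> t * D = G \<Longrightarrow> has_theta F G t"
  unfolding has_theta_def by blast

lemma has_theta_cong: "has_theta F G t \<Longrightarrow> G = H \<Longrightarrow> has_theta F H t"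
  by simp

lemma has_theta_mult:
  assumes "has_theta F F' t" "has_theta G G' t"
  shows "has_theta (\<lambda>s. F s * G s) (F' * G t + F t * G') t"
proof -
  obtain A B where "(F has_field_derivative A) (at t)" "(G has_field_derivative B) (at t)" "t * A = F'" "t * B = G'"
    using assms unfolding has_theta_def by blast
  then show ?thesis
    by (intro has_thetaI[of _ "A * G t + B * F t"] DERIV_mult) (auto simp: algebra_simps)
qed

lemma has_theta_add:
  assumes "has_theta F F' t" "has_theta G G' t"
  shows "has_theta (\<lambda>s. F s + G s) (F' + G') t"
proof -
  obtain A B where "(F has_field_derivative A) (at t)" "(G has_field_derivative B) (at t)" "t * A = F'" "t * B = G'"
    using assms unfolding has_theta_def by blast
  then show ?thesis
    by (intro has_thetaI[of _ "A + B"] DERIV_add) (auto simp: algebra_simps)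
qed

lemma has_theta_chain:
  assumes "has_theta F F' t" "(h has_field_derivative h') (at (F t))"
  shows "has_theta (\<lambda>s. h (F s)) (h' * F') t"
proof -
  obtain A where "(F has_field_derivative A) (at t)" "t * A = F'"
    using assms unfolding has_theta_def by blast
  then show ?thesis using assms(2)
    by (intro has_thetaI[of _ "h' * A"] DERIV_chain2) auto
qed

lemma has_theta_const: "has_theta (\<lambda>_. c) 0 t"
  by (intro has_thetaI[of _ 0]) auto

lemma has_theta_ident: "has_theta (\<lambda>s. s) t t"
  by (intro has_thetaI[of _ 1]) auto

lemma has_theta_minus: "has_theta F F' t \<Longrightarrow> has_theta (\<lambda>s. - F s) (- F') t"
  unfolding has_theta_def using DERIV_minus by fastforce

lemma has_theta_diff: "has_theta F F' t \<Longrightarrow> has_theta G G' t \<Longrightarrow> has_theta (\<lambda>s. F s - G s) (F' - G') t"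
  using has_theta_add[OF _ has_theta_minus, of F F' t G G'] by simp

lemma has_theta_cmult: "has_theta F F' t \<Longrightarrow> has_theta (\<lambda>s. c * F s) (c * F') t"
  using has_theta_mult[OF has_theta_const[of c]] by simp

lemma has_theta_divide:
  assumes "has_theta F F' t" "has_theta G G' t" "G t \<noteq> 0"
  shows "has_theta (\<lambda>s. F s / G s) ((F' * G t - F t * G') / (G t * G t)) t"
proof -
  obtain A B where "(F has_field_derivative A) (at t)" "(G has_field_derivative B) (at t)" "t * A = F'" "t * B = G'"
    using assms unfolding has_theta_def by blast
  then show ?thesis using assms(3)
    by (intro has_thetaI[of _ "(A * G t - F t * B) / (G t * G t)"] DERIV_divide) (auto simp: algebra_simps)
qed

lemma has_theta_cdivide: "has_theta F F' t \<Longrightarrow> has_theta (\<lambda>s. F s / c) (F' / c) t"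
  using has_theta_cmult[of F F' t "1 / c"] by simp

text \<open>Differentiating \<open>exp (L s) = h s\<close> gives the logarithmic derivative of
  \<open>h\<close>, whichever branch \<open>L\<close> is. All fractional powers in (1) that depend
  on \<open>t\<close> are differentiated this way.\<close>

lemma has_theta_log:
  assumes L: "L holomorphic_on S" "open S" "t \<in> S" and e: "\<And>s. s \<in> S \<Longrightarrow> exp (L s) = h s" and h: "has_theta h H t"
  shows "has_theta L (H / h t) t"
proof -
  obtain L' where L': "(L has_field_derivative L') (at t)"
    using L by (metis holomorphic_on_open)
  obtain h' where h': "(h has_field_derivative h') (at t)" "t * h' = H" using h unfolding has_theta_def by blast
  have "((\<lambda>s. exp (L s)) has_field_derivative exp (L t) * L') (at t)"
    by (auto intro!: derivative_eq_intros L')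
  then have "(h has_field_derivative exp (L t) * L') (at t)"
    by (rule has_field_derivative_transform_within_open[OF _ L(2,3)]) (use e in auto)
  then have "h' = h t * L'" using h'(1) e[OF L(3)] DERIV_unique by fastforce
  moreover have "h t \<noteq> 0" using e[OF L(3)] by (metis exp_not_eq_zero)
  ultimately show ?thesis using h'(2) by (intro has_thetaI[OF L']) (auto simp: field_simps)
qed

lemma has_fps_expansion_transform_on_open:
  assumes "open U" "0 \<in> U" "F has_fps_expansion \<phi>" "\<And>t. t \<in> U \<Longrightarrow> F t = G t"
  shows "G has_fps_expansion \<phi>"
proof -
  have "eventually (\<lambda>t. F t = G t) (nhds 0)"
    using eventually_nhds_in_open[OF assms(1,2)] by eventually_elim (rule assms(4))
  then show ?thesis using assms(3) by (simp add: has_fps_expansion_cong)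
qed

lemma has_fps_expansion_theta:
  assumes U: "open U" "0 \<in> U" and th: "\<And>t. t \<in> U \<Longrightarrow> has_theta F (G t) t"
    and F: "F has_fps_expansion \<phi>"
  shows "G has_fps_expansion fps_X * fps_deriv \<phi>"
proof -
  have "(\<lambda>t. t * deriv F t) has_fps_expansion fps_X * fps_deriv \<phi>"
    using F by (intro fps_expansion_intros)
  then show ?thesis
  proof (rule has_fps_expansion_transform_on_open[OF U])
    fix t assume "t \<in> U"
    then obtain D where "(F has_field_derivative D) (at t)" "t * D = G t"
      using th unfolding has_theta_def by blast
    then show "t * deriv F t = G t" by (simp add: DERIV_imp_deriv)
  qed
qed

text \<open>\<open>has_theta\<close> asserts differentiability even at 0, where its equation says
  nothing about the derivative.\<close>

lemma has_theta_imp_has_fps_expansion: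
  assumes U: "open U" "0 \<in> U" and th: "\<And>t. t \<in> U \<Longrightarrow> has_theta F (G t) t"
  shows "F has_fps_expansion fps_expansion F 0"
proof -
  have "F holomorphic_on U"
    using th unfolding holomorphic_on_open[OF U(1)] has_theta_def by blast
  then have "F analytic_on {0}" using U analytic_at by blast
  then show ?thesis by (rule analytic_at_imp_has_fps_expansion_0)
qed

text \<open>The common shape of \<open>Q\<close>, \<open>R\<close>, \<open>Y\<close> and
  \<open>Z\<close> below: coefficients and denominator depend on \<open>w\<close> alone. The
  hypothesis \<open>eq\<close> is the quotient rule cleared of denominators, so that it can be
  checked as a polynomial identity.\<close>

lemma has_theta_linear_quotient:
  fixes w :: "complex \<Rightarrow> complex" and B0 B1 B2 B3 ca cb cc cd d :: "complex \<Rightarrow> complex"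
  assumes w: "has_theta w (m / q) t"
    and B: "has_theta B0 (\<beta>0 / (144 * q)) t" "has_theta B1 (\<beta>1 / (144 * q)) t" "has_theta B2 (\<beta>2 / (144 * q)) t" "has_theta B3 (\<beta>3 / (144 * q)) t"
    and c: "(ca has_field_derivative ca') (at (w t))" "(cb has_field_derivative cb') (at (w t))" 
     "(cc has_field_derivative cc') (at (w t))" "(cd has_field_derivative cd') (at (w t))" "(d has_field_derivative d') (at (w t))"
    and nz: "d (w t) \<noteq> 0" "q \<noteq> 0"
    and eq: "((144 * ca' * m * B0 t + ca (w t) * \<beta>0) + (144 * cb' * m * B1 t + cb (w t) * \<beta>1)
       + (144 * cc' * m * B2 t + cc (w t) * \<beta>2) + (144 * cd' * m * B3 t + cd (w t) * \<beta>3)) * d (w t)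
       - 144 * d' * m * (ca (w t) * B0 t + cb (w t) * B1 t + cc (w t) * B2 t + cd (w t) * B3 t) = 144 * q * d (w t) ^ 2 * G"
  shows "has_theta (\<lambda>s. (ca (w s) * B0 s + cb (w s) * B1 s + cc (w s) * B2 s + cd (w s) * B3 s) / d (w s)) G t"
proof -
  note C = has_theta_chain[OF w c(1)] has_theta_chain[OF w c(2)] has_theta_chain[OF w c(3)] has_theta_chain[OF w c(4)] has_theta_chain[OF w c(5)]
  let ?N = "ca (w t) * B0 t + cb (w t) * B1 t + cc (w t) * B2 t + cd (w t) * B3 t"
  let ?N' = "(ca' * (m / q) * B0 t + ca (w t) * (\<beta>0 / (144 * q))) + (cb' * (m / q) * B1 t + cb (w t) * (\<beta>1 / (144 * q)))
      + (cc' * (m / q) * B2 t + cc (w t) * (\<beta>2 / (144 * q))) + (cd' * (m / q) * B3 t + cd (w t) * (\<beta>3 / (144 * q)))"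
  have "has_theta (\<lambda>s. (ca (w s) * B0 s + cb (w s) * B1 s + cc (w s) * B2 s + cd (w s) * B3 s) / d (w s))
     ((?N' * d (w t) - ?N * (d' * (m / q))) / (d (w t) * d (w t))) t"
    by (intro has_theta_divide has_theta_add has_theta_mult C B nz)
  moreover have "(?N' * d (w t) - ?N * (d' * (m / q))) / (d (w t) * d (w t)) = G"
  proof -
    have "144 * q * (?N' * d (w t) - ?N * (d' * (m / q))) = 144 * q * d (w t) ^ 2 * G"
      unfolding eq[symmetric] using nz(2) by (simp add: field_simps)
    then have "?N' * d (w t) - ?N * (d' * (m / q)) = d (w t) ^ 2 * G" using nz(2) by simp
    then show ?thesis using nz(1) by (simp add: power2_eq_square)
  qed
  ultimately show ?thesis by simp
qed

text \<open>
  In the application \<open>e\<close> is the algebraic prefactor, \<open>f\<close>, \<open>f1\<close> are \<open>F(11/12,19/12;3;\<cdot>)\<close> and its derivative at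
  \<open>w = t \<delta> / x\<close>, while \<open>g\<close>, \<open>g1\<close> are \<open>G(\<delta>)\<close> and \<open>\<delta> G'(\<delta>)\<close> for a solution \<open>G\<close> of the hypergeometric equation with
  parameters \<open>-7/12, 17/12; 1/3\<close>. The products \<open>B0, \<dots>, B3\<close> of these span a space closed under \<open>\<theta>\<close>.
\<close>

locale atkin_theta =
  fixes x :: complex and U :: "complex set" and w e f f1 g g1 :: "complex \<Rightarrow> complex"
  assumes open_U: "open U" and zero_U: "0 \<in> U"
    and tw: "\<And>t. t \<in> U \<Longrightarrow> t * (1 - w t) = w t * (1 - x * w t)"
    and w_neq_1: "\<And>t. t \<in> U \<Longrightarrow> w t \<noteq> 1"
    and q_neq_0: "\<And>t. t \<in> U \<Longrightarrow> 1 - 2 * x * w t + x * w t ^ 2 \<noteq> 0"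
    and th_w: "\<And>t. t \<in> U \<Longrightarrow> has_theta w (w t * (1 - w t) * (1 - x * w t) / (1 - 2 * x * w t + x * w t ^ 2)) t"
    and th_e: "\<And>t. t \<in> U \<Longrightarrow> has_theta e (e t * (72 * w t * (1 - x * w t) - 204 * w t * (1 - x)) / (144 * (1 - 2 * x * w t + x * w t ^ 2))) t"
    and th_f: "\<And>t. t \<in> U \<Longrightarrow> has_theta f (f1 t * (w t * (1 - w t) * (1 - x * w t)) / (1 - 2 * x * w t + x * w t ^ 2)) t"
    and th_f1: "\<And>t. t \<in> U \<Longrightarrow> has_theta f1 ((1 - x * w t) * (209 * f t - (432 - 504 * w t) * f1 t) / (144 * (1 - 2 * x * w t + x * w t ^ 2))) t"
    and th_g: "\<And>t. t \<in> U \<Longrightarrow> has_theta g (- (w t * (1 - x) * g1 t) / (1 - 2 * x * w t + x * w t ^ 2)) t"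
    and th_g1: "\<And>t. t \<in> U \<Longrightarrow> has_theta g1 (w t * (119 * x * (1 - w t) * g t + (48 * (1 - x * w t) - 264 * x * (1 - w t) - 144 * (1 - x)) * g1 t)
                  / (144 * (1 - 2 * x * w t + x * w t ^ 2))) t"
begin

text \<open>The numerator of \<open>dt/dw\<close> for \<open>t = w (1 - x w) / (1 - w)\<close>;
  hence \<open>\<theta> w = m / q\<close>.\<close>

definition "q t = 1 - 2 * x * w t + x * w t ^ 2"
definition "m t = w t * (1 - w t) * (1 - x * w t)"

definition "B0 t = e t * f t * g t"
definition "B1 t = e t * f1 t * g t"
definition "B2 t = e t * f t * g1 t"
definition "B3 t = e t * f1 t * g1 t"

text \<open>\<open>le\<close>, \<open>lf\<close> and \<open>lg\<close> are \<open>144 * q t\<close>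
  times the diagonal coefficients in \<open>\<theta> e\<close>, \<open>\<theta> f1\<close> and
  \<open>\<theta> g1\<close>.\<close>

definition "le t = 72 * w t * (1 - x * w t) - 204 * w t * (1 - x)"
definition "lf t = - ((1 - x * w t) * (432 - 504 * w t))"
definition "lg t = w t * (48 * (1 - x * w t) - 264 * x * (1 - w t) - 144 * (1 - x))"

definition "\<beta>0 t = le t * B0 t + 144 * m t * B1 t - 144 * w t * (1 - x) * B2 t"
definition "\<beta>1 t = 209 * (1 - x * w t) * B0 t + (le t + lf t) * B1 t - 144 * w t * (1 - x) * B3 t"
definition "\<beta>2 t = 119 * x * w t * (1 - w t) * B0 t + (le t + lg t) * B2 t + 144 * m t * B3 t"
definition "\<beta>3 t = 119 * x * w t * (1 - w t) * B1 t + 209 * (1 - x * w t) * B2 t + (le t + lf t + lg t) * B3 t"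

lemmas \<beta>_defs = \<beta>0_def \<beta>1_def \<beta>2_def \<beta>3_def
lemmas coeff_defs = le_def lf_def lg_def m_def

lemma theta_B:
  assumes t: "t \<in> U"
  shows "has_theta B0 (\<beta>0 t / (144 * q t)) t" "has_theta B1 (\<beta>1 t / (144 * q t)) t"
    "has_theta B2 (\<beta>2 t / (144 * q t)) t" "has_theta B3 (\<beta>3 t / (144 * q t)) t"
proof -
  have q: "q t \<noteq> 0" using q_neq_0[OF t] by (simp add: q_def)
  have scale: "a / q t = 144 * a / (144 * q t)" for a by simp
  note th = th_e[OF t, folded q_def] th_f[OF t, folded q_def, unfolded scale[of "f1 t * _"]] th_f1[OF t, folded q_def]
    th_g[OF t, folded q_def, unfolded scale[of "- _"]] th_g1[OF t, folded q_def]
  have prod3: "has_theta (\<lambda>s. E s * F s * G s) (d / (144 * q t)) t"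
    if "has_theta E (a / (144 * q t)) t" "has_theta F (b / (144 * q t)) t" "has_theta G (c / (144 * q t)) t"
       "d = (a * F t + E t * b) * G t + E t * F t * c" for E F G a b c d
    by (rule has_theta_cong[OF has_theta_mult[OF has_theta_mult[OF that(1,2)] that(3)]])
       (use q in \<open>simp add: that(4) add_divide_distrib ring_distribs\<close>)
  note defs = \<beta>_defs B0_def B1_def B2_def B3_def coeff_defs
  show "has_theta B0 (\<beta>0 t / (144 * q t)) t"
    unfolding B0_def[abs_def] by (rule prod3[OF th(1,2,4)]) (unfold defs, algebra)
  show "has_theta B1 (\<beta>1 t / (144 * q t)) t"
    unfolding B1_def[abs_def] by (rule prod3[OF th(1,3,4)]) (unfold defs, algebra)
  show "has_theta B2 (\<beta>2 t / (144 * q t)) t"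
    unfolding B2_def[abs_def] by (rule prod3[OF th(1,2,5)]) (unfold defs, algebra)
  show "has_theta B3 (\<beta>3 t / (144 * q t)) t"
    unfolding B3_def[abs_def] by (rule prod3[OF th(1,3,5)]) (unfold defs, algebra)
qed

text \<open>
  \<open>Q\<close> is \<open>(\<theta> + x \<partial>/\<partial>x + 17/12) B0\<close> taken at fixed \<open>t\<close>, with \<open>G\<close> independent of \<open>x\<close>. \<open>Y\<close> and \<open>Z\<close> are first integrals that
  turn the two second-order equations for \<open>R = Q - 2 (\<theta> + 1) B0\<close> and \<open>B0\<close> into first-order ones; in them the
  discriminant factor \<open>q\<close> cancels.
\<close>

definition "LQ t = (17 - 11 * w t) * B0 t + (12 * w t - 12 * w t ^ 2) * B1 t + (12 - 12 * w t) * B2 t + 0 * B3 t"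
definition "LR t = (- 7 + 11 * w t + 14 * x * w t - 12 * x * w t ^ 2) * B0 t
    + (- 12 * w t + 12 * w t ^ 2 + 24 * x * w t ^ 2 - 24 * x * w t ^ 3) * B1 t + (12 + 12 * w t - 24 * x * w t) * B2 t + 0 * B3 t"
definition "LY t = (21 * w t - 28) * B0 t + (14 * w t ^ 2 - 14 * w t) * B1 t + (48 - 36 * w t) * B2 t + (24 * w t - 24 * w t ^ 2) * B3 t"
definition "LZ t = (24 - 31 * w t - 17 * x * w t + 24 * x * w t ^ 2) * B0 t
    + (12 * w t - 12 * w t ^ 2 - 12 * x * w t ^ 2 + 12 * x * w t ^ 3) * B1 t + (12 * w t - 12 * x * w t) * B2 t + 0 * B3 t"

definition "Q t = LQ t / (12 * q t)"
definition "R t = LR t / (12 * q t)"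
definition "Y t = LY t / (24 * (1 - w t))"
definition "Z t = LZ t / (12 * (1 - w t))"

text \<open>\<open>NQ\<close> and \<open>NR\<close> are \<open>144 * q t\<close> times
  \<open>\<theta> LQ\<close> and \<open>\<theta> LR\<close>.\<close>

definition "NQ t = (144 * (- 11) * m t * B0 t + (17 - 11 * w t) * \<beta>0 t) + (144 * (12 - 24 * w t) * m t * B1 t + (12 * w t - 12 * w t ^ 2) * \<beta>1 t)
    + (144 * (- 12) * m t * B2 t + (12 - 12 * w t) * \<beta>2 t)"
definition "NR t = (144 * (11 + 14 * x - 24 * x * w t) * m t * B0 t + (- 7 + 11 * w t + 14 * x * w t - 12 * x * w t ^ 2) * \<beta>0 t)
    + (144 * (- 12 + 24 * w t + 48 * x * w t - 72 * x * w t ^ 2) * m t * B1 t + (- 12 * w t + 12 * w t ^ 2 + 24 * x * w t ^ 2 - 24 * x * w t ^ 3) * \<beta>1 t)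
    + (144 * (12 - 24 * x) * m t * B2 t + (12 + 12 * w t - 24 * x * w t) * \<beta>2 t)"

definition "Q1 t = (NQ t * q t - 144 * (2 * x * w t - 2 * x) * m t * LQ t) / (1728 * q t ^ 3)"
definition "R1 t = (NR t * q t - 144 * (2 * x * w t - 2 * x) * m t * LR t) / (1728 * q t ^ 3)"

text \<open>The constants are what remains of the second-order operators once
  \<open>\<theta>\<close> is split off: \<open>- 7/144 = (19/12) (11/12) - 3/2\<close> and
  \<open>65/144 = (17/12) (25/12) - 5/2\<close>.\<close>

lemma theta_Q_R_Y_Z:
  assumes t: "t \<in> U"
  shows "has_theta Q (Q1 t) t" "has_theta R (R1 t) t" "has_theta Y (- (7/144) * (t * Q t)) t"
    "has_theta Z (t * (65/144 * B0 t - (1 - x) * Q t)) t"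
proof -
  have q: "q t \<noteq> 0" using q_neq_0[OF t] by (simp add: q_def)
  have w1: "1 - w t \<noteq> 0" using w_neq_1[OF t] by simp
  have tw': "t * (1 - w t) = w t * (1 - x * w t)" by (rule tw[OF t])
  note lin = has_theta_linear_quotient[OF th_w[OF t, folded q_def m_def] theta_B[OF t]]
  have "has_theta (\<lambda>s. LQ s / (12 * (1 - 2 * x * w s + x * w s ^ 2))) (Q1 t) t" unfolding LQ_def
  proof (rule lin[where ca' = "- 11" and cb' = "12 - 24 * w t" and cc' = "- 12" and cd' = 0 and d' = "12 * (2 * x * w t - 2 * x)"
            and d = "\<lambda>v. 12 * (1 - 2 * x * v + x * v ^ 2)" and ca = "\<lambda>v. 17 - 11 * v" and cb = "\<lambda>v. 12 * v - 12 * v ^ 2"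
            and cc = "\<lambda>v. 12 - 12 * v" and cd = "\<lambda>v. 0"], goal_cases)
    \<comment> \<open>Goal 8 is the cleared quotient rule and goal 6 the nonvanishing of the
      denominator; the others are derivatives in \<open>w\<close> and
      \<open>q t \<noteq> 0\<close>.\<close>
    case 8
    have "144 * q t * (12 * q t) ^ 2 * Q1 t = 12 * (NQ t * q t - 144 * (2 * x * w t - 2 * x) * m t * LQ t)"
      using q by (simp add: Q1_def power2_eq_square power3_eq_cube)
    then show ?case unfolding LQ_def NQ_def q_def by algebra
  next
    case 6
    show ?case using q_neq_0[OF t] by (simp only: mult_eq_0_iff) simp
  qed (use q in \<open>auto intro!: derivative_eq_intros simp: algebra_simps\<close>)
  then show "has_theta Q (Q1 t) t" by (simp add: Q_def[abs_def] q_def)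
  have "has_theta (\<lambda>s. LR s / (12 * (1 - 2 * x * w s + x * w s ^ 2))) (R1 t) t" unfolding LR_def
  proof (rule lin[where ca' = "11 + 14 * x - 24 * x * w t" and cb' = "- 12 + 24 * w t + 48 * x * w t - 72 * x * w t ^ 2" and cc' = "12 - 24 * x" and cd' = 0 and d' = "12 * (2 * x * w t - 2 * x)"
            and d = "\<lambda>v. 12 * (1 - 2 * x * v + x * v ^ 2)" and ca = "\<lambda>v. - 7 + 11 * v + 14 * x * v - 12 * x * v ^ 2" and cb = "\<lambda>v. - 12 * v + 12 * v ^ 2 + 24 * x * v ^ 2 - 24 * x * v ^ 3"
            and cc = "\<lambda>v. 12 + 12 * v - 24 * x * v" and cd = "\<lambda>v. 0"], goal_cases)
    case 8
    have "144 * q t * (12 * q t) ^ 2 * R1 t = 12 * (NR t * q t - 144 * (2 * x * w t - 2 * x) * m t * LR t)"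
      using q by (simp add: R1_def power2_eq_square power3_eq_cube)
    then show ?case unfolding LR_def NR_def q_def by algebra
  next
    case 6
    show ?case using q_neq_0[OF t] by (simp only: mult_eq_0_iff) simp
  qed (use q in \<open>auto intro!: derivative_eq_intros simp: algebra_simps\<close>)
  then show "has_theta R (R1 t) t" by (simp add: R_def[abs_def] q_def)
  have "has_theta (\<lambda>s. LY s / (24 * (1 - w s))) (- (7/144) * (t * Q t)) t" unfolding LY_def
  proof (rule lin[where ca' = "21" and cb' = "28 * w t - 14" and cc' = "- 36" and cd' = "24 - 48 * w t" and d' = "- 24"
            and d = "\<lambda>v. 24 * (1 - v)" and ca = "\<lambda>v. 21 * v - 28" and cb = "\<lambda>v. 14 * v ^ 2 - 14 * v" and cc = "\<lambda>v. 48 - 36 * v" and cd = "\<lambda>v. 24 * v - 24 * v ^ 2"], goal_cases)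
    case 8
    have "144 * q t * (24 * (1 - w t)) ^ 2 * (- (7/144) * (t * Q t)) = - 336 * (1 - w t) * (t * (1 - w t)) * LQ t"
      using q by (simp add: Q_def power2_eq_square field_simps)
    \<comment> \<open>\<open>t\<close> occurs only with the factor \<open>1 - w t\<close>, so
      \<open>tw'\<close> eliminates it.\<close>
    also have "\<dots> = - 336 * (1 - w t) * (w t * (1 - x * w t)) * LQ t" by (simp only: tw')
    finally show ?case unfolding LQ_def \<beta>_defs coeff_defs by algebra
  qed (use q w1 in \<open>auto intro!: derivative_eq_intros simp: algebra_simps\<close>)
  then show "has_theta Y (- (7/144) * (t * Q t)) t" by (simp add: Y_def[abs_def])
  have "has_theta (\<lambda>s. LZ s / (12 * (1 - w s))) (t * (65/144 * B0 t - (1 - x) * Q t)) t" unfolding LZ_def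
  proof (rule lin[where ca' = "- 31 - 17 * x + 48 * x * w t" and cb' = "12 - 24 * w t - 24 * x * w t + 36 * x * w t ^ 2" and cc' = "12 - 12 * x" and cd' = 0 and d' = "- 12"
            and d = "\<lambda>v. 12 * (1 - v)" and ca = "\<lambda>v. 24 - 31 * v - 17 * x * v + 24 * x * v ^ 2" and cb = "\<lambda>v. 12 * v - 12 * v ^ 2 - 12 * x * v ^ 2 + 12 * x * v ^ 3"
            and cc = "\<lambda>v. 12 * v - 12 * x * v" and cd = "\<lambda>v. 0"], goal_cases)
    case 8
    have "144 * q t * (12 * (1 - w t)) ^ 2 * (t * (65/144 * B0 t - (1 - x) * Q t))
        = (t * (1 - w t)) * (1 - w t) * (9360 * q t * B0 t - 1728 * (1 - x) * LQ t)"
      using q by (simp add: Q_def power2_eq_square field_simps)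
    also have "\<dots> = (w t * (1 - x * w t)) * (1 - w t) * (9360 * q t * B0 t - 1728 * (1 - x) * LQ t)" by (simp only: tw')
    finally show ?case unfolding LQ_def \<beta>_defs coeff_defs q_def by algebra
  qed (use q w1 in \<open>auto intro!: derivative_eq_intros simp: algebra_simps\<close>)
  then show "has_theta Z (t * (65/144 * B0 t - (1 - x) * Q t)) t" by (simp add: Z_def[abs_def])
qed

text \<open>Applying \<open>\<theta>\<close> to the last two relations and inserting the derivatives
  of \<open>Y\<close> and \<open>Z\<close> returns the two second-order equations, because
  \<open>\<theta> (t F) = t (\<theta> + 1) F\<close>.\<close>

lemma first_order_relations:
  assumes t: "t \<in> U"
  shows "R t = Q t - 2 * B0 t - 2 * (\<beta>0 t / (144 * q t))"
    and "R1 t + 2 * R t = t * (Q1 t + 3/2 * Q t) + Y t"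
    and "\<beta>0 t / (144 * q t) + 2 * B0 t = t * (\<beta>0 t / (144 * q t) + 5/2 * B0 t) - 2 * (1 - x) * (t * Q t) + Z t"
proof -
  have q: "q t \<noteq> 0" using q_neq_0[OF t] by (simp add: q_def)
  have w1: "1 - w t \<noteq> 0" using w_neq_1[OF t] by simp
  have tw': "t * (1 - w t) = w t * (1 - x * w t)" by (rule tw[OF t])
  have "6 * LR t = 6 * LQ t - 144 * q t * B0 t - \<beta>0 t"
    unfolding LQ_def LR_def \<beta>_defs coeff_defs q_def by algebra
  then have "LR t = LQ t - 24 * q t * B0 t - \<beta>0 t / 6" by (simp add: field_simps)
  then show "R t = Q t - 2 * B0 t - 2 * (\<beta>0 t / (144 * q t))"
    using q by (simp add: R_def Q_def diff_divide_distrib)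
  define nR where "nR = NR t * q t - 144 * (2 * x * w t - 2 * x) * m t * LR t"
  define nQ where "nQ = NQ t * q t - 144 * (2 * x * w t - 2 * x) * m t * LQ t"
  have "(1 - w t) * (nR + 288 * q t ^ 2 * LR t) = (t * (1 - w t)) * (nQ + 216 * q t ^ 2 * LQ t) + 72 * q t ^ 3 * LY t"
    unfolding tw' unfolding nR_def nQ_def NR_def NQ_def LQ_def LR_def LY_def \<beta>_defs coeff_defs q_def by algebra
  moreover have "1728 * q t ^ 3 * R1 t = nR" "1728 * q t ^ 3 * Q1 t = nQ"
    "12 * q t * R t = LR t" "12 * q t * Q t = LQ t" "24 * (1 - w t) * Y t = LY t"
    using q w1 by (simp_all add: R1_def Q1_def R_def Q_def Y_def nR_def nQ_def del: distrib_left_numeral distrib_right_numeral right_diff_distrib_numeral left_diff_distrib_numeral)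
  ultimately have "(1 - w t) * ((1728 * q t ^ 3) * (R1 t + 2 * R t)) = (1 - w t) * ((1728 * q t ^ 3) * (t * (Q1 t + 3/2 * Q t) + Y t))"
    by algebra
  then show "R1 t + 2 * R t = t * (Q1 t + 3/2 * Q t) + Y t" using q w1 by simp
  have "(1 - w t) * (\<beta>0 t + 288 * q t * B0 t) = (t * (1 - w t)) * (\<beta>0 t + 360 * q t * B0 t) - 24 * (1 - x) * (t * (1 - w t)) * LQ t + 12 * q t * LZ t"
    unfolding tw' unfolding LQ_def LZ_def \<beta>_defs coeff_defs q_def by algebra
  moreover have "144 * q t * (\<beta>0 t / (144 * q t)) = \<beta>0 t" "12 * q t * Q t = LQ t" "12 * (1 - w t) * Z t = LZ t"
    using q w1 by (simp_all add: Q_def Z_def del: distrib_left_numeral distrib_right_numeral right_diff_distrib_numeral left_diff_distrib_numeral)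
  ultimately have "(1 - w t) * ((144 * q t) * (\<beta>0 t / (144 * q t) + 2 * B0 t))
       = (1 - w t) * ((144 * q t) * (t * (\<beta>0 t / (144 * q t) + 5/2 * B0 t) - 2 * (1 - x) * (t * Q t) + Z t))"
    by algebra
  then show "\<beta>0 t / (144 * q t) + 2 * B0 t = t * (\<beta>0 t / (144 * q t) + 5/2 * B0 t) - 2 * (1 - x) * (t * Q t) + Z t"
    using q w1 by simp
qed

end

section \<open>From the differential equations to the three-term recurrence\<close>

context atkin_theta
begin

lemma coeff_recurrences:
  defines "p \<equiv> fps_expansion B0 0" and "r \<equiv> fps_expansion Q 0"
  shows "B0 has_fps_expansion p" "Q has_fps_expansion r"
    and "(of_nat n + 1) * (of_nat n + 3) * p $ Suc n
         = (of_nat n + 17/12) * (of_nat n + 25/12) * p $ n - (1 - x) * (2 * of_nat n + 3) * r $ n"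
    and "(of_nat n + 1) * (of_nat n + 3) * (r $ Suc n - 2 * (of_nat n + 2) * p $ Suc n)
         = (of_nat n + 19/12) * (of_nat n + 11/12) * r $ n"
proof -
  note U = open_U zero_U
  show p: "B0 has_fps_expansion p" unfolding p_def
    by (rule has_theta_imp_has_fps_expansion[OF U]) (rule theta_B(1))
  show r: "Q has_fps_expansion r" unfolding r_def
    by (rule has_theta_imp_has_fps_expansion[OF U]) (rule theta_Q_R_Y_Z(1))
  define y z where "y = fps_expansion Y 0" and "z = fps_expansion Z 0"
  have y: "Y has_fps_expansion y" unfolding y_def
    by (rule has_theta_imp_has_fps_expansion[OF U]) (rule theta_Q_R_Y_Z(3))
  have z: "Z has_fps_expansion z" unfolding z_def
    by (rule has_theta_imp_has_fps_expansion[OF U]) (rule theta_Q_R_Y_Z(4))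
  have p1: "(\<lambda>t. \<beta>0 t / (144 * q t)) has_fps_expansion fps_X * fps_deriv p"
    by (rule has_fps_expansion_theta[OF U theta_B(1) p])
  have r1: "Q1 has_fps_expansion fps_X * fps_deriv r"
    by (rule has_fps_expansion_theta[OF U theta_Q_R_Y_Z(1) r])
  have eqI: "\<phi> = \<psi>" if "F has_fps_expansion \<phi>" "G has_fps_expansion \<psi>" "\<And>t. t \<in> U \<Longrightarrow> F t = G t" for F G :: "complex \<Rightarrow> complex" and \<phi> \<psi>
    by (rule fps_expansion_unique_complex[OF has_fps_expansion_transform_on_open[OF U that(1,3)] that(2)])
  define k where "k = r - 2 * p - 2 * (fps_X * fps_deriv p)"
  have k: "R has_fps_expansion k"
  proof (rule has_fps_expansion_transform_on_open[OF U])
    show "(\<lambda>t. Q t - 2 * B0 t - 2 * (\<beta>0 t / (144 * q t))) has_fps_expansion k"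
      unfolding k_def by (intro fps_expansion_intros p r p1)
  qed (simp add: first_order_relations(1))
  have k1: "R1 has_fps_expansion fps_X * fps_deriv k"
    by (rule has_fps_expansion_theta[OF U theta_Q_R_Y_Z(2) k])
  have e1: "fps_X * fps_deriv k + 2 * k = fps_X * (fps_X * fps_deriv r + fps_const (3/2) * r) + y"
  proof (rule eqI[OF _ _ first_order_relations(2)])
    show "(\<lambda>t. R1 t + 2 * R t) has_fps_expansion fps_X * fps_deriv k + 2 * k"
      by (intro fps_expansion_intros k k1)
    show "(\<lambda>t. t * (Q1 t + 3/2 * Q t) + Y t) has_fps_expansion fps_X * (fps_X * fps_deriv r + fps_const (3/2) * r) + y"
      by (intro fps_expansion_intros r r1 y)
  qed
  have e2: "fps_X * fps_deriv y = fps_const (- (7/144)) * (fps_X * r)"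
  proof (rule eqI[OF has_fps_expansion_theta[OF U theta_Q_R_Y_Z(3) y] _ refl])
    show "(\<lambda>t. - (7/144) * (t * Q t)) has_fps_expansion fps_const (- (7/144)) * (fps_X * r)"
      by (intro fps_expansion_intros r)
  qed
  have e3: "fps_X * fps_deriv p + 2 * p = fps_X * (fps_X * fps_deriv p + fps_const (5/2) * p) - fps_const (2 * (1 - x)) * (fps_X * r) + z"
  proof (rule eqI[OF _ _ first_order_relations(3)])
    show "(\<lambda>t. \<beta>0 t / (144 * q t) + 2 * B0 t) has_fps_expansion fps_X * fps_deriv p + 2 * p"
      by (intro fps_expansion_intros p p1)
    show "(\<lambda>t. t * (\<beta>0 t / (144 * q t) + 5/2 * B0 t) - 2 * (1 - x) * (t * Q t) + Z t) has_fps_expansion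
       fps_X * (fps_X * fps_deriv p + fps_const (5/2) * p) - fps_const (2 * (1 - x)) * (fps_X * r) + z"
      by (intro has_fps_expansion_add has_fps_expansion_diff has_fps_expansion_mult has_fps_expansion_const has_fps_expansion_fps_X p p1 r z)
  qed
  have e4: "fps_X * fps_deriv z = fps_X * (fps_const (65/144) * p - fps_const (1 - x) * r)"
  proof (rule eqI[OF has_fps_expansion_theta[OF U theta_Q_R_Y_Z(4) z] _ refl])
    show "(\<lambda>t. t * (65/144 * B0 t - (1 - x) * Q t)) has_fps_expansion fps_X * (fps_const (65/144) * p - fps_const (1 - x) * r)"
      by (intro fps_expansion_intros p r)
  qed
  define N where "N = (of_nat n :: complex)"
  have kn: "k $ Suc n = r $ Suc n - 2 * (N + 2) * p $ Suc n"
    by (simp add: k_def N_def numeral_fps_const algebra_simps)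
  have f1: "(N + 3) * k $ Suc n = (N + 3/2) * r $ n + y $ Suc n"
    using arg_cong[OF e1, of "\<lambda>F. F $ Suc n"] by (cases n) (simp_all add: N_def numeral_fps_const algebra_simps)
  have f2: "(N + 1) * y $ Suc n = - (7/144) * r $ n"
    using arg_cong[OF e2, of "\<lambda>F. F $ Suc n"] by (simp add: N_def algebra_simps)
  have f3: "(N + 3) * p $ Suc n = (N + 5/2) * p $ n - 2 * (1 - x) * r $ n + z $ Suc n"
    using arg_cong[OF e3, of "\<lambda>F. F $ Suc n"] by (cases n) (simp_all add: N_def numeral_fps_const algebra_simps)
  have f4: "(N + 1) * z $ Suc n = 65/144 * p $ n - (1 - x) * r $ n"
    using arg_cong[OF e4, of "\<lambda>F. F $ Suc n"] by (simp add: N_def algebra_simps)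
  \<comment> \<open>On the coefficient of index \<open>n + 1\<close> the operator
    \<open>\<theta>\<close> is multiplication by \<open>N + 1\<close>, so this factor lets
    \<open>f4\<close> eliminate \<open>z\<close>.\<close>
  have "(N + 1) * (N + 3) * p $ Suc n = (N + 1) * ((N + 5/2) * p $ n - 2 * (1 - x) * r $ n) + (N + 1) * z $ Suc n"
    using arg_cong[OF f3, of "\<lambda>F. (N + 1) * F"] by (simp add: algebra_simps)
  also have "\<dots> = (N + 17/12) * (N + 25/12) * p $ n - (1 - x) * (2 * N + 3) * r $ n"
    unfolding f4 by (simp add: field_simps)
  finally show "(of_nat n + 1) * (of_nat n + 3) * p $ Suc n
         = (of_nat n + 17/12) * (of_nat n + 25/12) * p $ n - (1 - x) * (2 * of_nat n + 3) * r $ n"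
    by (simp only: N_def)
  have "(N + 1) * (N + 3) * k $ Suc n = (N + 1) * ((N + 3/2) * r $ n) + (N + 1) * y $ Suc n"
    using arg_cong[OF f1, of "\<lambda>F. (N + 1) * F"] by (simp add: algebra_simps)
  also have "\<dots> = (N + 19/12) * (N + 11/12) * r $ n"
    unfolding f2 by (simp add: field_simps)
  finally show "(of_nat n + 1) * (of_nat n + 3) * (r $ Suc n - 2 * (of_nat n + 2) * p $ Suc n)
         = (of_nat n + 19/12) * (of_nat n + 11/12) * r $ n"
    by (simp only: N_def kn)
qed

text \<open>The coefficients \<open>r\<close> are eliminated together with their factor
  \<open>(1 - x) * (2 * N + 3)\<close>, so nothing is divided; this explains the common factor left
  in place.\<close>

lemma three_term_recurrence:
  fixes n :: nat
  defines "p \<equiv> fps_expansion B0 0" and "N \<equiv> of_nat n :: complex"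
  shows "(N + 1) * (N + 3) * (2 * N + 3) * ((N + 2) * (N + 4) * p $ Suc (Suc n))
     = (N + 1) * (N + 3) * (2 * N + 3) * ((N + 29/12) * (N + 37/12) - 2 * (N + 2) * (2 * N + 5) * (1 - x)) * p $ Suc n
      - (2 * N + 5) * (N + 19/12) * (N + 11/12) * ((N + 17/12) * (N + 25/12) * p $ n - (N + 1) * (N + 3) * p $ Suc n)"
proof -
  define r where "r = fps_expansion Q 0"
  note c = coeff_recurrences[folded p_def r_def]
  have 1: "(N + 1) * (N + 3) * p $ Suc n = (N + 17/12) * (N + 25/12) * p $ n - (1 - x) * (2 * N + 3) * r $ n"
    using c(3)[of n] by (simp only: N_def)
  have 2: "(N + 2) * (N + 4) * p $ Suc (Suc n) = (N + 29/12) * (N + 37/12) * p $ Suc n - (1 - x) * (2 * N + 5) * r $ Suc n"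
    using c(3)[of "Suc n"] by (simp add: N_def algebra_simps)
  have 3: "(N + 1) * (N + 3) * (r $ Suc n - 2 * (N + 2) * p $ Suc n) = (N + 19/12) * (N + 11/12) * r $ n"
    using c(4)[of n] by (simp only: N_def)
  have "(N + 1) * (N + 3) * (2 * N + 3) * ((N + 2) * (N + 4) * p $ Suc (Suc n))
     = (N + 1) * (N + 3) * (2 * N + 3) * ((N + 29/12) * (N + 37/12)) * p $ Suc n
      - (1 - x) * (2 * N + 5) * (2 * N + 3) * ((N + 1) * (N + 3) * (r $ Suc n - 2 * (N + 2) * p $ Suc n)
        + (N + 1) * (N + 3) * (2 * (N + 2) * p $ Suc n))"
    unfolding 2 by (simp only: algebra_simps)
  also have "\<dots> = (N + 1) * (N + 3) * (2 * N + 3) * ((N + 29/12) * (N + 37/12) - 2 * (N + 2) * (2 * N + 5) * (1 - x)) * p $ Suc n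
      - (2 * N + 5) * (N + 19/12) * (N + 11/12) * ((1 - x) * (2 * N + 3) * r $ n)"
    unfolding 3 by (simp only: algebra_simps)
  also have "(1 - x) * (2 * N + 3) * r $ n = (N + 17/12) * (N + 25/12) * p $ n - (N + 1) * (N + 3) * p $ Suc n"
    unfolding 1 by simp
  finally show ?thesis .
qed

end

subsection \<open>Catalan multiples of the Atkin polynomials\<close>

lemma catalan_fact: "catalan n = fact (2 * n) / (fact n * fact (n + 1))"
  by (simp add: catalan_def binomial_fact field_simps)

lemma catalan_Suc: "(real n + 2) * catalan (Suc n) = 2 * (2 * real n + 1) * catalan n"
proof -
  have f2: "fact (2 * Suc n) = (2 * real n + 2) * (2 * real n + 1) * fact (2 * n)"
    by (simp add: algebra_simps)
  have f1: "fact (Suc n + 1) = (real n + 2) * (real n + 1) * fact n" "fact (Suc n) = (real n + 1) * fact n"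
    "fact (n + 1) = (real n + 1) * (fact n :: real)"
    by (simp_all add: algebra_simps)
  have "real n + 1 \<noteq> 0" "real n + 2 \<noteq> 0" by linarith+
  then show ?thesis unfolding catalan_fact f2 f1
    by (simp add: divide_simps) (simp add: algebra_simps)
qed

lemma catalan_1: "catalan 1 = 1" and catalan_2: "catalan 2 = 2"
  by (simp_all add: catalan_fact fact_numeral)

text \<open>With \<open>n = k + 2\<close> the four factors become \<open>k + 11/12\<close>,
  \<open>k + 17/12\<close>, \<open>k + 19/12\<close> and \<open>k + 25/12\<close>, the ones in the
  recurrences for \<open>p\<close> and \<open>r\<close>.\<close>

lemma poly_scaled_atkin_rec:
  "poly (scaled_atkin (k + 3)) x =
     (x - 2 * ((real k + 2)\<^sup>2 - 29/144) / (4 * (real k + 2)\<^sup>2 - 1)) * poly (scaled_atkin (k + 2)) x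
     - (real k + 11/12) * (real k + 17/12) * (real k + 19/12) * (real k + 25/12)
        / (4 * (real k + 2) * (2 * real k + 3)\<^sup>2 * (real k + 1)) * poly (scaled_atkin (k + 1)) x"
proof -
  have i: "k + 3 = Suc (Suc (Suc k))" "k + 2 = Suc (Suc k)" "k + 1 = Suc k" by simp_all
  show ?thesis unfolding i scaled_atkin.simps Let_def
    by (simp add: algebra_simps)
qed

text \<open>Kept in exactly the shape of \<open>three_term_recurrence\<close>, common factor
  included, so that the two sequences can be compared.\<close>

lemma catalan_atkin_recurrence:
  fixes x :: real and k :: nat
  defines "a \<equiv> \<lambda>n. catalan (n + 1) * poly (scaled_atkin (n + 1)) x" and "N \<equiv> real k"
  shows "(N + 1) * (N + 3) * (2 * N + 3) * ((N + 2) * (N + 4) * a (Suc (Suc k)))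
     = (N + 1) * (N + 3) * (2 * N + 3) * ((N + 29/12) * (N + 37/12) - 2 * (N + 2) * (2 * N + 5) * (1 - x)) * a (Suc k)
      - (2 * N + 5) * (N + 19/12) * (N + 11/12) * ((N + 17/12) * (N + 25/12) * a k - (N + 1) * (N + 3) * a (Suc k))"
proof -
  define A0 A1 c0 where "A0 = poly (scaled_atkin (k + 1)) x" and "A1 = poly (scaled_atkin (k + 2)) x"
    and "c0 = catalan (k + 1)"
  have N: "N + 1 \<noteq> 0" "N + 2 \<noteq> 0" "N + 3 \<noteq> 0" "N + 4 \<noteq> 0" "2 * N + 3 \<noteq> 0" "2 * N + 5 \<noteq> 0"
    unfolding N_def by linarith+
  have c1: "catalan (k + 2) = 2 * (2 * N + 3) / (N + 3) * c0"
    by (rule eq_quotient_mult) (use catalan_Suc[of "k + 1"] N in \<open>simp_all add: c0_def N_def algebra_simps\<close>)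
  have c2: "catalan (k + 3) = 2 * (2 * N + 5) / (N + 4) * catalan (k + 2)"
    by (rule eq_quotient_mult) (use catalan_Suc[of "k + 2"] N in \<open>simp_all add: N_def numeral_3_eq_3 algebra_simps\<close>)
  have d: "4 * (N + 2)\<^sup>2 - 1 = (2 * N + 3) * (2 * N + 5)" by (simp add: power2_eq_square algebra_simps)
  have a: "a k = c0 * A0" "a (Suc k) = catalan (k + 2) * A1" "a (Suc (Suc k)) = catalan (k + 3) * poly (scaled_atkin (k + 3)) x"
    by (simp_all add: a_def c0_def A0_def A1_def add.commute numeral_3_eq_3 del: scaled_atkin.simps)
  show ?thesis
    unfolding a poly_scaled_atkin_rec A0_def[symmetric] A1_def[symmetric] N_def[symmetric] d c2 c1
    using N by (simp add: divide_simps del: distrib_left_numeral distrib_right_numeral) algebra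
qed

text \<open>At \<open>x = 0\<close> the recursion has a solution whose consecutive terms have a
  rational ratio, \<open>s_Suc\<close>. The induction carries two consecutive values; the explicit
  quadratic supplies the second base value.\<close>

lemma poly_scaled_atkin_0:
  "poly (scaled_atkin (n + 1)) 0 = (- 1) ^ n * (- (5/12)) * (pochhammer (11/12) n * pochhammer (17/12) n / fact (2 * n + 1))"
proof -
  define s :: "nat \<Rightarrow> real" where "s n = (- 1) ^ n * (- (5/12)) * (pochhammer (11/12) n * pochhammer (17/12) n / fact (2 * n + 1))" for n
  have s_Suc: "s (Suc n) = - ((real n + 11/12) * (real n + 17/12) / ((2 * real n + 2) * (2 * real n + 3))) * s n" for n
  proof -
    have "fact (2 * Suc n + 1) = (2 * real n + 2) * (2 * real n + 3) * fact (2 * n + 1)"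
      by (simp add: algebra_simps)
    then show ?thesis by (simp add: s_def pochhammer_Suc add.commute mult_ac)
  qed
  have "poly (scaled_atkin (n + 1)) 0 = s n \<and> poly (scaled_atkin (n + 2)) 0 = s (n + 1)"
  proof (induction n)
    case 0
    show ?case by (simp add: s_def pochhammer_Suc numeral_2_eq_2 fact_numeral)
  next
    case (Suc n)
    define N where "N = real n"
    have ih: "poly (scaled_atkin (n + 1)) 0 = s n" "poly (scaled_atkin (n + 2)) 0 = s (Suc n)" using Suc by simp_all
    have N: "N + 1 \<noteq> 0" "N + 2 \<noteq> 0" "2 * N + 3 \<noteq> 0" "2 * N + 5 \<noteq> 0" "2 * N + 2 \<noteq> 0" "2 * N + 4 \<noteq> 0"
      unfolding N_def by linarith+
    have d: "4 * (N + 2)\<^sup>2 - 1 = (2 * N + 3) * (2 * N + 5)" by (simp add: power2_eq_square algebra_simps)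
    have s1: "s (Suc n) = - ((N + 11/12) * (N + 17/12) / ((2 * N + 2) * (2 * N + 3))) * s n"
      by (simp add: s_Suc N_def)
    have "s (Suc (Suc n)) = - ((N + 23/12) * (N + 29/12) / ((2 * N + 4) * (2 * N + 5))) * s (Suc n)"
      by (subst s_Suc) (simp add: N_def algebra_simps)
    moreover have "poly (scaled_atkin (n + 3)) 0 = - ((N + 23/12) * (N + 29/12) / ((2 * N + 4) * (2 * N + 5))) * s (Suc n)"
      unfolding poly_scaled_atkin_rec N_def[symmetric] d ih s1 using N
      by (simp add: divide_simps del: distrib_left_numeral distrib_right_numeral) algebra
    ultimately have "poly (scaled_atkin (n + 3)) 0 = s (Suc (Suc n))" by simp
    then show ?case using Suc by (simp add: numeral_3_eq_3 del: scaled_atkin.simps)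
  qed
  then show ?thesis by (simp add: s_def)
qed

text \<open>Termwise from the closed form: since \<open>(n + 2)! = 2 (3)_n\<close>, the quotient of
  \<open>catalan (n + 1)\<close> by \<open>(2 n + 1)!\<close> is \<open>1 / ((3)_n n!)\<close>, and
  the signs cancel against \<open>(- t) ^ n\<close>.\<close>

lemma atkin_gf_at_0:
  assumes t: "norm t < 1"
  shows "(\<lambda>n. complex_of_real (catalan (n + 1) * poly (scaled_atkin (n + 1)) 0) * (- t) ^ n) sums
            (- (5/12) * hyp2f1 (11/12) (17/12) 3 t)"
proof -
  note np = params_not_nonpos_Int(6,9,14)
  have p3: "fact (n + 2) = 2 * pochhammer (3::real) n" for n
    by (induction n) (simp_all add: pochhammer_Suc algebra_simps fact_numeral)
  have cat: "catalan (n + 1) / fact (2 * n + 1) = 1 / (pochhammer 3 n * fact n)" for n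
  proof -
    have "fact (2 * (n + 1)) = (2 * real n + 2) * fact (2 * n + 1)" "fact (n + 1) = (real n + 1) * fact n"
      "fact (n + 1 + 1) = 2 * pochhammer (3::real) n"
      using p3[of n] by (simp_all add: algebra_simps)
    moreover have "real n + 1 \<noteq> 0" "pochhammer (3::real) n \<noteq> 0" 
      using pochhammer_pos[of "3::real" n] by linarith+
    ultimately show ?thesis unfolding catalan_fact by (simp add: divide_simps)
  qed
  have "complex_of_real (catalan (n + 1) * poly (scaled_atkin (n + 1)) 0) * (- t) ^ n
     = - (5/12) * (pochhammer (11/12) n * pochhammer (17/12) n / (pochhammer 3 n * fact n) * t ^ n)" for n
  proof -
    have "catalan (n + 1) * poly (scaled_atkin (n + 1)) 0 = (- 1) ^ n * (- (5/12)) * (pochhammer (11/12) n * pochhammer (17/12) n) * (catalan (n + 1) / fact (2 * n + 1))"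
      unfolding poly_scaled_atkin_0 by simp
    also have "\<dots> = (- 1) ^ n * (- (5/12) * (pochhammer (11/12) n * pochhammer (17/12) n / (pochhammer 3 n * fact n)))"
      unfolding cat by simp
    finally have e: "complex_of_real (catalan (n + 1) * poly (scaled_atkin (n + 1)) 0)
       = (- 1) ^ n * (- (5/12) * (pochhammer (11/12) n * pochhammer (17/12) n / (pochhammer 3 n * fact n)))"
      by (simp del: scaled_atkin.simps add: pochhammer_of_real[symmetric])
    show ?thesis unfolding e by (cases "even n") simp_all
  qed
  then show ?thesis using sums_mult[OF sums_hyp2f1[OF np t], of "- (5/12)"] by simp
qed

subsection \<open>Branches and the function \<open>\<delta>\<close>\<close>

text \<open>Any analytic logarithm that is real at 0 evaluates the description. A rival logarithm
  differs by a constant \<open>k\<close> with \<open>exp k = 1\<close>, so \<open>k\<close> is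
  imaginary; \<open>p\<close> being real, the powers differ by a unimodular factor, which positivity
  at 0 makes 1.\<close>

lemma power_branch_eqI:
  assumes L: "L holomorphic_on ball 0 1" and e: "\<And>s. s \<in> ball 0 1 \<Longrightarrow> exp (L s) = h s"
    and im: "Im (L 0) = 0" and t: "t \<in> ball 0 1"
  shows "power_branch p h t = exp (complex_of_real p * L t)"
proof -
  have pos: "exp (complex_of_real p * L 0) = complex_of_real (exp (p * Re (L 0)))"
    using im by (metis Reals_cases Re_complex_of_real complex_is_Real_iff exp_of_real of_real_mult)
  have ex: "is_power_branch p h (\<lambda>t. exp (complex_of_real p * L t))"
    unfolding is_power_branch_def using L e pos by (intro conjI exI[of _ L] exI[of _ "exp (p * Re (L 0))"]) auto
  have un: "w = exp (complex_of_real p * L t)" if w: "\<exists>g. is_power_branch p h g \<and> w = g t" for w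
  proof -
    obtain g K r where K: "K holomorphic_on ball 0 1"
      "\<And>s. s \<in> ball 0 1 \<Longrightarrow> exp (K s) = h s"
      "\<And>s. s \<in> ball 0 1 \<Longrightarrow> g s = exp (complex_of_real p * K s)"
      and r: "r > 0" "g 0 = complex_of_real r" and wg: "w = g t"
      using w unfolding is_power_branch_def by blast
    have dd: "((\<lambda>s. K s - L s) has_field_derivative 0) (at s within ball 0 1)" if s: "s \<in> ball 0 1" for s
    proof -
      obtain K' where K': "(K has_field_derivative K') (at s)"
        using K(1) s by (meson analytic_on_imp_differentiable_at analytic_on_open field_differentiable_def open_ball)
      obtain L' where L': "(L has_field_derivative L') (at s)"
        using L s by (meson analytic_on_imp_differentiable_at analytic_on_open field_differentiable_def open_ball)
      have "((\<lambda>s. exp (K s) - exp (L s)) has_field_derivative exp (K s) * K' - exp (L s) * L') (at s)"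
        by (auto intro!: derivative_eq_intros K' L')
      moreover have "((\<lambda>s. exp (K s) - exp (L s)) has_field_derivative 0) (at s)"
        by (rule has_field_derivative_transform_within_open[of "\<lambda>_. 0" _ _ "ball 0 1"])
           (use s K(2) e in auto)
      ultimately have "exp (K s) * K' - exp (L s) * L' = 0" by (rule DERIV_unique)
      then have "K' = L'" using K(2)[OF s] e[OF s] by auto
      then have "((\<lambda>s. K s - L s) has_field_derivative 0) (at s)"
        using DERIV_diff[OF K' L'] by simp
      then show ?thesis by (rule has_field_derivative_at_within)
    qed
    obtain k where k: "\<And>s. s \<in> ball 0 1 \<Longrightarrow> K s - L s = k"
      using has_field_derivative_zero_constant[OF convex_ball dd] by blast
    define u where "u = exp (complex_of_real p * k)"
    have gu: "g s = u * exp (complex_of_real p * L s)" if "s \<in> ball 0 1" for s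
    proof -
      have "K s = k + L s" using k[OF that] by (simp add: algebra_simps)
      then show ?thesis using K(3)[OF that] by (simp add: u_def exp_add distrib_left)
    qed
    have "exp (k) = 1" using K(2)[of 0] e[of 0] k[of 0] by (auto simp: exp_diff)
    then have "Re k = 0" by (metis exp_eq_1)
    then have nu: "norm u = 1" by (simp add: u_def)
    have "u * complex_of_real (exp (p * Re (L 0))) = complex_of_real r"
      using gu[of 0] r pos by simp
    then have "u = complex_of_real (r / exp (p * Re (L 0)))"
      by (simp add: field_simps)
    then have "u = 1" using nu r(1) by (metis abs_of_pos divide_pos_pos exp_gt_zero norm_of_real of_real_1)
    then show ?thesis using gu[OF t] wg by simp
  qed
  show ?thesis unfolding power_branch_def
    by (rule the_equality) (use ex un in blast)+
qed

lemma holomorphic_log_ball: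
  assumes h: "h holomorphic_on ball 0 1" and nz: "\<And>t. t \<in> ball 0 1 \<Longrightarrow> h t \<noteq> 0"
    and h0: "h 0 = complex_of_real c" and c: "c > 0"
  obtains L where "L holomorphic_on ball 0 1" "\<And>t. t \<in> ball 0 1 \<Longrightarrow> exp (L t) = h t" "L 0 = complex_of_real (ln c)"
proof -
  obtain K where K: "K holomorphic_on ball 0 1" "\<And>t. t \<in> ball 0 1 \<Longrightarrow> h t = exp (K t)"
    by (rule contractible_imp_holomorphic_log[OF h _ nz]) (auto simp: convex_imp_contractible)
  show ?thesis
  proof (rule that)
    show "(\<lambda>t. K t - K 0 + complex_of_real (ln c)) holomorphic_on ball 0 1"
      by (intro holomorphic_intros K)
    show "exp (K t - K 0 + complex_of_real (ln c)) = h t" if "t \<in> ball 0 1" for t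
    proof -
      have "exp (complex_of_real (ln c)) = h 0" using c h0 by (simp add: exp_of_real)
      then show ?thesis using K(2)[OF that] K(2)[of 0] by (simp add: exp_add exp_diff)
    qed
  qed simp
qed

section \<open>The square root, \<open>\<delta>\<close> and \<open>w\<close> on the unit
  disc\<close>

text \<open>As a polynomial in \<open>t\<close> this is \<open>t^2 + 2 (1 - 2 x) t + 1\<close> with
  negative discriminant: the roots are conjugate with product 1, hence on the unit circle.\<close>

lemma atkin_radicand_nonzero:
  assumes x: "0 < x" "x < 1" and t: "norm t < 1"
  shows "(1 + t)\<^sup>2 - 4 * complex_of_real x * t \<noteq> 0"
proof
  assume eq: "(1 + t)\<^sup>2 - 4 * complex_of_real x * t = 0"
  define a b where "a = Re t" and "b = Im t"
  have re: "(1 + a)\<^sup>2 - b\<^sup>2 - 4 * x * a = 0" and im: "2 * (1 + a) * b - 4 * x * b = 0"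
    using arg_cong[OF eq, of Re] arg_cong[OF eq, of Im] by (simp_all add: a_def b_def power2_eq_square)
  have "(norm t)\<^sup>2 < 1" using t by (simp add: power_less_one_iff)
  then have ab: "a\<^sup>2 + b\<^sup>2 < 1" by (simp add: a_def b_def cmod_power2)
  show False
  proof (cases "b = 0")
    case True
    have "(1 + a)\<^sup>2 - 4 * x * a = (a + (1 - 2 * x))\<^sup>2 + 4 * x * (1 - x)"
      by (simp add: power2_eq_square algebra_simps)
    moreover have "4 * x * (1 - x) > 0" using x by simp
    ultimately show False using re True by (smt (verit) zero_le_power2 power_zero_numeral)
  next
    case False
    have "b * (2 * (1 + a) - 4 * x) = 0" using im by (simp add: algebra_simps)
    then have a: "a = 2 * x - 1" using False by simp
    have "a\<^sup>2 + b\<^sup>2 = 1" using re unfolding a by (simp add: power2_eq_square algebra_simps)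
    then show False using ab by simp
  qed
qed

text \<open>Rationalising the numerator of \<open>\<delta>\<close> removes the singularity at 0. The
  new denominator times \<open>1 + t - r t\<close> is \<open>4 x t\<close>, so it could vanish only
  at \<open>t = 0\<close>, where it equals 2.\<close>

lemma atkin_delta_root:
  assumes x: "0 < x" "x < 1"
  obtains r where "r holomorphic_on ball 0 1" "r 0 = 1"
    "\<And>t. t \<in> ball 0 1 \<Longrightarrow> (r t)\<^sup>2 = (1 + t)\<^sup>2 - 4 * complex_of_real x * t"
    "\<And>t. t \<in> ball 0 1 \<Longrightarrow> r t \<noteq> 0 \<and> 1 + t + r t \<noteq> 0 \<and> atkin_delta x t = 2 * complex_of_real x / (1 + t + r t)"
proof -
  let ?h = "\<lambda>s. (1 + s)\<^sup>2 - 4 * complex_of_real x * s"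
  have nz: "?h t \<noteq> 0" if "t \<in> ball 0 1" for t
    by (rule atkin_radicand_nonzero[OF x]) (use that in simp)
  obtain L where L: "L holomorphic_on ball 0 1" "\<And>t. t \<in> ball 0 1 \<Longrightarrow> exp (L t) = ?h t" "L 0 = complex_of_real (ln 1)"
    by (rule holomorphic_log_ball[of ?h 1]) (use nz in \<open>auto intro!: holomorphic_intros\<close>)
  define r where "r = (\<lambda>t. exp (complex_of_real (1/2) * L t))"
  have pb: "power_branch (1/2) ?h t = r t" if "t \<in> ball 0 1" for t
    unfolding r_def by (rule power_branch_eqI[OF L(1,2)]) (use L(3) that in auto)
  have r2: "(r t)\<^sup>2 = ?h t" if "t \<in> ball 0 1" for t
    using L(2)[OF that] by (simp add: r_def exp_double[symmetric])
  have r0: "r 0 = 1" by (simp add: r_def L(3))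
  show ?thesis
  proof (rule that)
    show "r holomorphic_on ball 0 1" unfolding r_def by (intro holomorphic_intros L)
    fix t :: complex assume t: "t \<in> ball 0 1"
    have rt: "r t \<noteq> 0" by (simp add: r_def)
    have prod: "(1 + t - r t) * (1 + t + r t) = 4 * complex_of_real x * t"
      using r2[OF t] by (simp add: power2_eq_square algebra_simps)
    have ne: "1 + t + r t \<noteq> 0"
    proof
      assume z: "1 + t + r t = 0"
      then have "t = 0" using prod x by simp
      then show False using z r0 by simp
    qed
    have "atkin_delta x t = 2 * complex_of_real x / (1 + t + r t)"
    proof (cases "t = 0")
      case True then show ?thesis by (simp add: atkin_delta_def r0)
    next
      case False
      define v where "v = 1 + t + r t"
      have "1 + t - r t = 4 * complex_of_real x * t / v"
        using prod ne by (simp add: nonzero_eq_divide_eq v_def)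
      then have "atkin_delta x t = 4 * complex_of_real x * t / v / (2 * t)"
        using False by (simp add: atkin_delta_def pb[OF t])
      also have "\<dots> = 2 * complex_of_real x / v" using False by simp
      finally show ?thesis by (simp only: v_def)
    qed
    with rt ne show "r t \<noteq> 0 \<and> 1 + t + r t \<noteq> 0 \<and> atkin_delta x t = 2 * complex_of_real x / (1 + t + r t)" by simp
  qed (use r0 r2 in auto)
qed

lemma atkin_delta_0: "atkin_delta x 0 = complex_of_real x"
  by (simp add: atkin_delta_def)

lemma atkin_delta_basic:
  assumes x: "0 < x" "x < 1"
  shows "atkin_delta x holomorphic_on ball 0 1"
    and "t \<in> ball 0 1 \<Longrightarrow> t * (atkin_delta x t)\<^sup>2 - (1 + t) * atkin_delta x t + complex_of_real x = 0"
    and "t \<in> ball 0 1 \<Longrightarrow> atkin_delta x t \<noteq> 0"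
    and "t \<in> ball 0 1 \<Longrightarrow> 1 + t - 2 * t * atkin_delta x t \<noteq> 0"
proof -
  obtain r where r: "r holomorphic_on ball 0 1"
    "\<And>t. t \<in> ball 0 1 \<Longrightarrow> (r t)\<^sup>2 = (1 + t)\<^sup>2 - 4 * complex_of_real x * t"
    "\<And>t. t \<in> ball 0 1 \<Longrightarrow> r t \<noteq> 0 \<and> 1 + t + r t \<noteq> 0 \<and> atkin_delta x t = 2 * complex_of_real x / (1 + t + r t)"
    using atkin_delta_root[OF x] by metis
  have "(\<lambda>t. 2 * complex_of_real x / (1 + t + r t)) holomorphic_on ball 0 1"
    by (intro holomorphic_intros r) (use r(3) in auto)
  then show "atkin_delta x holomorphic_on ball 0 1"
    by (rule holomorphic_transform) (use r(3) in auto)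
  assume t: "t \<in> ball 0 1"
  define u where "u = 1 + t + r t"
  have u: "u \<noteq> 0" "atkin_delta x t = 2 * complex_of_real x / u" using r(3)[OF t] by (auto simp: u_def)
  have "u * u - 2 * (1 + t) * u + 4 * complex_of_real x * t = 0"
    using r(2)[OF t] by (simp add: u_def power2_eq_square algebra_simps)
  then have e: "4 * complex_of_real x * t = 2 * (1 + t) * u - u * u" by (simp add: algebra_simps)
  have "t * (atkin_delta x t)\<^sup>2 - (1 + t) * atkin_delta x t + complex_of_real x
     = complex_of_real x * (4 * complex_of_real x * t - 2 * (1 + t) * u + u * u) / (u * u)"
    unfolding u(2) using u(1) by (simp add: field_simps power2_eq_square)
  then show "t * (atkin_delta x t)\<^sup>2 - (1 + t) * atkin_delta x t + complex_of_real x = 0"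
    unfolding e by simp
  show "atkin_delta x t \<noteq> 0" using u x by simp
  \<comment> \<open>This factor is the square root \<open>r t\<close> itself.\<close>
  have "(1 + t - 2 * t * atkin_delta x t) * u = (1 + t) * u - 4 * complex_of_real x * t"
    unfolding u(2) using u(1) by (simp add: field_simps)
  also have "\<dots> = r t * u" unfolding e by (simp add: u_def algebra_simps)
  finally have "1 + t - 2 * t * atkin_delta x t = r t" using u(1) by simp
  then show "1 + t - 2 * t * atkin_delta x t \<noteq> 0" using r(3)[OF t] by simp
qed

text \<open>On the circle \<open>\<bar>\<delta>\<bar> = \<surd>x\<close> the quadratic equation for \<open>\<delta>\<close> forces \<open>\<bar>t\<bar> = 1\<close>, so \<open>\<bar>\<delta>\<bar>\<close> cannot cross \<open>\<surd>x\<close> inside the disc.\<close>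

lemma norm_atkin_delta_less:
  assumes x: "0 < x" "x < 1" and t: "t \<in> ball 0 1"
  shows "norm (atkin_delta x t) < sqrt x"
proof (rule ccontr)
  assume "\<not> norm (atkin_delta x t) < sqrt x"
  then have ge: "norm (atkin_delta x t) \<ge> sqrt x" by simp
  have cont: "continuous_on (ball 0 1) (\<lambda>s. norm (atkin_delta x s))"
    by (intro continuous_on_norm holomorphic_on_imp_continuous_on atkin_delta_basic x)
  have "x < sqrt x" using x by (simp add: real_less_rsqrt power2_eq_square)
  then have le: "norm (atkin_delta x 0) \<le> sqrt x" using x by (simp add: atkin_delta_0)
  have "connected ((\<lambda>s. norm (atkin_delta x s)) ` ball 0 1)"
    by (intro connected_continuous_image cont connected_ball)
  then have "sqrt x \<in> (\<lambda>s. norm (atkin_delta x s)) ` ball 0 1"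
    using ge le t by (meson connected_iff_interval imageI centre_in_ball zero_less_one)
  then obtain s where s: "s \<in> ball 0 1" "norm (atkin_delta x s) = sqrt x" by auto
  define d where "d = atkin_delta x s"
  have "s * d * (1 - d) = complex_of_real x - d"
    using atkin_delta_basic(2)[OF x s(1)] by (simp add: d_def power2_eq_square algebra_simps)
  then have "norm s * norm d * norm (1 - d) = norm (complex_of_real x - d)"
    by (metis norm_mult)
  then have eq: "(norm s)\<^sup>2 * (norm d)\<^sup>2 * (norm (1 - d))\<^sup>2 = (norm (complex_of_real x - d))\<^sup>2"
    by (metis power_mult_distrib)
  have nd: "(norm d)\<^sup>2 = x" using s x by (simp add: d_def)
  then have ri: "(Re d)\<^sup>2 + (Im d)\<^sup>2 = x" by (simp add: cmod_power2)
  have 1: "(norm (1 - d))\<^sup>2 = 1 - 2 * Re d + x"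
    unfolding cmod_power2 ri[symmetric] by (simp add: power2_eq_square algebra_simps)
  have "(norm (complex_of_real x - d))\<^sup>2 = x\<^sup>2 - 2 * x * Re d + ((Re d)\<^sup>2 + (Im d)\<^sup>2)"
    unfolding cmod_power2 by (simp add: power2_eq_square algebra_simps)
  \<comment> \<open>The circle \<open>\<bar>d\<bar> = sqrt x\<close> is the Apollonius circle of the
    points \<open>x\<close> and 1 with ratio \<open>sqrt x\<close>.\<close>
  then have 2: "(norm (complex_of_real x - d))\<^sup>2 = x * (norm (1 - d))\<^sup>2"
    unfolding 1 ri by (simp add: power2_eq_square algebra_simps)
  have "sqrt x < 1" using x by simp
  then have "d \<noteq> 1" using s(2) by (auto simp: d_def)
  then have "(norm s)\<^sup>2 = 1" using eq unfolding 2 nd using x by simp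
  then have "norm s = 1" by (simp add: power2_eq_1_iff) (smt (verit) norm_ge_zero)
  then show False using s(1) by simp
qed


text \<open>The algebraic claims come from the quadratic equation with \<open>t * d = X * w\<close>.
  For the last one, a real \<open>w = v > 1\<close> would give
  \<open>\<bar>\<delta>\<bar> = x (v - 1) / \<bar>1 - x v\<bar>\<close> and
  \<open>\<bar>t\<bar> = v \<bar>1 - x v\<bar> / (v - 1)\<close>, which cannot stay below
  \<open>sqrt x\<close> and 1 together.\<close>

lemma atkin_w:
  assumes x: "0 < x" "x < 1" and t: "t \<in> ball 0 1"
  defines "X \<equiv> complex_of_real x" and "d \<equiv> atkin_delta x t"
  defines "w \<equiv> t * d / X"
  shows "d * (1 - X * w) = X * (1 - w)" "1 - X * w \<noteq> 0" "1 - w \<noteq> 0" "t * (1 - w) = w * (1 - X * w)"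
    "1 - 2 * X * w + X * w\<^sup>2 = (1 + t - 2 * t * d) * (1 - w)" "(1 - X * w) * (1 - d) = 1 - X"
    "X - t * d = X * (1 - w)" "w \<in> cut_plane"
proof -
  have X: "X \<noteq> 0" "1 - X \<noteq> 0" using x by (auto simp: X_def)
  have td: "t * d = X * w" using X by (simp add: w_def)
  have d0: "d \<noteq> 0" unfolding d_def by (rule atkin_delta_basic(3)[OF x t])
  have "t * d * d - (1 + t) * d + X = 0"
    using atkin_delta_basic(2)[OF x t] by (simp add: d_def X_def power2_eq_square mult.assoc)
  then have "(t * d) * d - d - t * d + X = 0" by (simp add: algebra_simps)
  then show dw: "d * (1 - X * w) = X * (1 - w)" unfolding td by (simp add: algebra_simps)
  show w1: "1 - w \<noteq> 0"
  proof
    assume "1 - w = 0"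
    then have "w = 1" by simp
    then have "d * (1 - X) = 0" using dw by simp
    then show False using d0 X by simp
  qed
  show Xw: "1 - X * w \<noteq> 0" using dw w1 X by auto
  have "X * (t * (1 - w)) = t * d * (1 - X * w)" using dw by (simp add: mult_ac)
  then have "X * (t * (1 - w)) = X * (w * (1 - X * w))" unfolding td by (simp add: mult_ac)
  then show tw: "t * (1 - w) = w * (1 - X * w)" using X by simp
  have "(1 + t - 2 * t * d) * (1 - w) = (1 - 2 * (t * d)) * (1 - w) + t * (1 - w)"
    by (simp add: algebra_simps)
  also have "\<dots> = 1 - 2 * X * w + X * w\<^sup>2" unfolding tw td by (simp add: power2_eq_square algebra_simps)
  finally show "1 - 2 * X * w + X * w\<^sup>2 = (1 + t - 2 * t * d) * (1 - w)" by simp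
  have "(1 - X * w) * (1 - d) = (1 - X * w) - d * (1 - X * w)" by (simp add: algebra_simps)
  also have "\<dots> = 1 - X" unfolding dw by (simp add: algebra_simps)
  finally show "(1 - X * w) * (1 - d) = 1 - X" .
  show "X - t * d = X * (1 - w)" unfolding td by (simp add: algebra_simps)
  show "w \<in> cut_plane"
  proof (rule ccontr)
    assume "w \<notin> cut_plane"
    then obtain v where v: "v \<ge> 1" "w = complex_of_real v" by auto
    have v1: "v > 1" using w1 v by (cases "v = 1") auto
    have dn: "norm d < sqrt x" unfolding d_def by (rule norm_atkin_delta_less[OF x t])
    have tn: "norm t < 1" using t by simp
    define s where "s = sqrt x"
    have sx: "0 < s" "s < 1" "x = s * s" using x by (simp_all add: s_def)
    have "complex_of_real (1 - x * v) \<noteq> 0" using Xw v by (simp add: X_def)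
    then have xv: "1 - x * v \<noteq> 0" by (metis of_real_0)
    have "norm d * \<bar>1 - x * v\<bar> = x * (v - 1)"
    proof -
      have "norm (d * complex_of_real (1 - x * v)) = norm (complex_of_real (x * (1 - v)))"
        using dw v by (simp add: X_def)
      then show ?thesis using v1 x by (simp only: norm_mult norm_of_real abs_mult) simp
    qed
    moreover have "norm d * \<bar>1 - x * v\<bar> < s * \<bar>1 - x * v\<bar>"
      using dn[folded s_def] xv by (intro mult_strict_right_mono) auto
    ultimately have "s * (s * (v - 1)) < s * \<bar>1 - x * v\<bar>"
      unfolding sx(3) by (simp add: mult.assoc)
    then have b1: "s * (v - 1) < \<bar>1 - x * v\<bar>" using sx(1) by simp
    have "norm t * (v - 1) = v * \<bar>1 - x * v\<bar>"
    proof -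
      have "norm (t * complex_of_real (1 - v)) = norm (complex_of_real (v * (1 - x * v)))"
        using tw v by (simp add: X_def)
      then show ?thesis using v1 by (simp only: norm_mult norm_of_real abs_mult) simp
    qed
    moreover have "norm t * (v - 1) < 1 * (v - 1)" using tn v1 by (intro mult_strict_right_mono) auto
    ultimately have b2: "v * \<bar>1 - x * v\<bar> < v - 1" by simp
    show False
    \<comment> \<open>If \<open>x v < 1\<close>, the bound on \<open>d\<close> forces
      \<open>x v^2 < 1\<close> and the bound on \<open>t\<close> forces \<open>x v^2 > 1\<close>.
      Otherwise the bound on \<open>d\<close> already fails.\<close>
    proof (cases "x * v < 1")
      case True
      have "(1 - s * v) * (1 + s) = 1 - x * v - s * (v - 1)"
        unfolding sx(3) by (simp add: algebra_simps)
      then have "(1 - s * v) * (1 + s) > 0" using b1 True by simp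
      then have "s * v < 1" using sx by (simp add: zero_less_mult_iff)
      then have "(s * v) * (s * v) < 1 * 1" using sx v1 by (intro mult_strict_mono) auto
      then have "x * v * v < 1" unfolding sx(3) by (simp add: mult_ac)
      moreover have "v * (1 - x * v) < v - 1" using b2 True by simp
      ultimately show False by (simp add: algebra_simps)
    next
      case False
      have "s * (v - 1) < x * v - 1" using b1 False by simp
      moreover have "x * v - 1 - s * (v - 1) = - ((1 - s) * (1 + s * v))"
        unfolding sx(3) by (simp add: algebra_simps)
      moreover have "(1 - s) * (1 + s * v) > 0" using sx v1 by (intro mult_pos_pos add_pos_pos) auto
      ultimately show False by linarith
    qed
  qed
qed

subsection \<open>The generating function\<close>

text \<open>At \<open>t = 0\<close> one has \<open>\<delta> = x\<close>: these are the bracket of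
  (1) there and its image under \<open>\<delta> d/d\<delta>\<close>.\<close>

lemma atkin_CD_eval:
  assumes x: "0 < x" "x < 1"
  defines "X \<equiv> complex_of_real x"
    and "y \<equiv> hyp_fps (- 7/12) (17/12) (1/3)" and "z \<equiv> hyp_fps (1/12) (25/12) (5/3)"
  shows "atkin_C x * eval_fps y X + atkin_D x * eval_fps z X = X - 5/12"
    and "(1 - X) * (atkin_C x * (X * eval_fps (fps_deriv y) X) + atkin_D x * (2/3 * eval_fps z X + X * eval_fps (fps_deriv z) X))
         = X * (7/8 - 7/12 * X)"
proof -
  define ok where "ok F \<longleftrightarrow> ereal (norm X) < fps_conv_radius F" for F :: "complex fps"
  have X: "norm X < 1" using x by (simp add: X_def)
  have ok_hyp: "ok (hyp_fps a b c)" if "a \<notin> \<int>\<^sub>\<le>\<^sub>0" "b \<notin> \<int>\<^sub>\<le>\<^sub>0" "c \<notin> \<int>\<^sub>\<le>\<^sub>0" for a b c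
    using hyp_fps_conv_radius[OF that] X by (simp add: ok_def)
  have okI: "ok (A * B)" "ok (A + B)" "ok (A - B)" if "ok A" "ok B" for A B
    using that fps_conv_radius_mult[of A B] fps_conv_radius_add[of A B] fps_conv_radius_diff[of A B]
    unfolding ok_def by (meson less_le_trans min_less_iff_conj)+
  have okD: "ok (fps_deriv A)" if "ok A" for A
    using that fps_conv_radius_deriv[of A] unfolding ok_def by (meson less_le_trans)
  have okC: "ok 1" "ok fps_X" "ok (numeral k)" for k by (simp_all add: ok_def)
  have hom: "eval_fps (A * B) X = eval_fps A X * eval_fps B X" "eval_fps (A + B) X = eval_fps A X + eval_fps B X"
    "eval_fps (A - B) X = eval_fps A X - eval_fps B X" if "ok A" "ok B" for A B
    using that by (simp_all add: ok_def eval_fps_mult eval_fps_add eval_fps_diff)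
  define p1 p2 q1 q2 where "p1 = hyp_fps (- 5/12) (- 5/12) (- 1/3)" and "p2 = hyp_fps (- 5/12) (- 5/12) (2/3)"
    and "q1 = hyp_fps (- 1/12) (- 1/12) (1/3)" and "q2 = hyp_fps (11/12) (- 1/12) (4/3)"
  have oks: "ok p1" "ok p2" "ok q1" "ok q2" "ok y" "ok z"
    unfolding p1_def p2_def q1_def q2_def y_def z_def
    by (intro ok_hyp params_not_nonpos_Int)+
  define P1 P2 Q1 Q2 y0 y1 z0 z1 where "P1 = eval_fps p1 X" and "P2 = eval_fps p2 X" and "Q1 = eval_fps q1 X" and "Q2 = eval_fps q2 X"
    and "y0 = eval_fps y X" and "y1 = eval_fps (fps_deriv y) X" and "z0 = eval_fps z X" and "z1 = eval_fps (fps_deriv z) X"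
  have C: "atkin_C x = - (1/60) * (24 * P1 + P2)"
    using X by (simp add: atkin_C_def P1_def P2_def p1_def p2_def hyp2f1_eq_eval_fps X_def)
  have D: "atkin_D x = 91/384 * X * (4 * Q1 - 5 * Q2)"
    using X by (simp add: atkin_D_def Q1_def Q2_def q1_def q2_def hyp2f1_eq_eval_fps X_def)
  note E = atkin_CD_fps[folded y_def z_def p1_def p2_def q1_def q2_def, THEN arg_cong, of "\<lambda>F. eval_fps F X"]
  have 1: "5 * (X * (91 * (4 * Q1 - 5 * Q2)) * z0) - 16 * ((48 * P1 + 2 * P2) * y0) = 160 * (12 * X - 5)"
    using E(1) by (simp add: hom oks okI okD okC P1_def P2_def Q1_def Q2_def y0_def z0_def)
  have 2: "(1 - X) * (5 * (X * (91 * (4 * Q1 - 5 * Q2))) * (3 * (X * z1) + 2 * z0) - 48 * ((48 * P1 + 2 * P2) * (X * y1))) = X * (5040 - 3360 * X)"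
    using E(2) by (simp add: hom oks okI okD okC P1_def P2_def Q1_def Q2_def y0_def z0_def y1_def z1_def)
  \<comment> \<open>\<open>48 P1 + 2 P2\<close> is \<open>- 120 C\<close> and
    \<open>91 X (4 Q1 - 5 Q2)\<close> is \<open>384 D\<close>; the common factor is
    \<open>16 * 120 = 5 * 384\<close>.\<close>
  have "1920 * (atkin_C x * y0 + atkin_D x * z0) = 5 * (X * (91 * (4 * Q1 - 5 * Q2)) * z0) - 16 * ((48 * P1 + 2 * P2) * y0)"
    unfolding C D by (simp add: field_simps)
  also have "\<dots> = 1920 * (X - 5/12)" unfolding 1 by simp
  finally show "atkin_C x * eval_fps y X + atkin_D x * eval_fps z X = X - 5/12"
    unfolding y0_def[symmetric] z0_def[symmetric] by (simp only: mult_cancel_left) simp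
  have "5760 * ((1 - X) * (atkin_C x * (X * y1) + atkin_D x * (2/3 * z0 + X * z1)))
     = (1 - X) * (5 * (X * (91 * (4 * Q1 - 5 * Q2))) * (3 * (X * z1) + 2 * z0) - 48 * ((48 * P1 + 2 * P2) * (X * y1)))"
    unfolding C D by (simp add: field_simps)
  also have "\<dots> = 5760 * (X * (7/8 - 7/12 * X))" unfolding 2 by (simp add: algebra_simps)
  finally show "(1 - X) * (atkin_C x * (X * eval_fps (fps_deriv y) X) + atkin_D x * (2/3 * eval_fps z X + X * eval_fps (fps_deriv z) X))
         = X * (7/8 - 7/12 * X)"
    unfolding y1_def[symmetric] z0_def[symmetric] z1_def[symmetric] by (simp only: mult_cancel_left) simp
qed

text \<open>Implicit differentiation of the quadratic equation gives
  \<open>(1 + t - 2 t \<delta>) \<delta>' = \<delta>^2 - \<delta>\<close>; \<open>atkin_w\<close>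
  rewrites this in \<open>w\<close>.\<close>

lemma atkin_theta_delta_w:
  assumes x: "0 < x" "x < 1" and t: "t \<in> ball 0 1"
  defines "X \<equiv> complex_of_real x"
  defines "w \<equiv> \<lambda>s. s * atkin_delta x s / X"
  defines "q \<equiv> 1 - 2 * X * w t + X * (w t)\<^sup>2"
  shows "has_theta (atkin_delta x) (atkin_delta x t * (- (w t * (1 - X)) / q)) t"
    and "has_theta w (w t * (1 - w t) * (1 - X * w t) / q) t" and "q \<noteq> 0"
proof -
  define d where "d = atkin_delta x t"
  note W = atkin_w[OF x t, folded X_def d_def]
  have w: "w t = t * d / X" by (simp add: w_def d_def)
  note W' = W[folded w]
  have X: "X \<noteq> 0" using x by (simp add: X_def)
  have r: "1 + t - 2 * t * d \<noteq> 0" using atkin_delta_basic(4)[OF x t] by (simp add: d_def)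
  then show q: "q \<noteq> 0" using W'(3,5) by (simp add: q_def)
  obtain d' where d': "(atkin_delta x has_field_derivative d') (at t)"
    using atkin_delta_basic(1)[OF x] t holomorphic_on_open by blast
  have "((\<lambda>s. s * (atkin_delta x s)\<^sup>2 - (1 + s) * atkin_delta x s + X) has_field_derivative
      d * d + 2 * t * d * d' - d - (1 + t) * d') (at t)"
    by (auto intro!: derivative_eq_intros d' simp: d_def power2_eq_square algebra_simps)
  moreover have "((\<lambda>s. s * (atkin_delta x s)\<^sup>2 - (1 + s) * atkin_delta x s + X) has_field_derivative 0) (at t)"
    by (rule has_field_derivative_transform_within_open[of "\<lambda>_. 0" _ _ "ball 0 1"])
       (use t atkin_delta_basic(2)[OF x] in \<open>auto simp: X_def\<close>)
  ultimately have "d * d + 2 * t * d * d' - d - (1 + t) * d' = 0" by (rule DERIV_unique)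
  then have rd: "(1 + t - 2 * t * d) * d' = d * d - d" by (simp add: algebra_simps)
  have "q * (t * d') = (1 - w t) * (t * ((1 + t - 2 * t * d) * d'))"
    unfolding q_def W'(5) by (simp add: mult_ac)
  also have "\<dots> = (t * d) * (1 - w t) * (d - 1)" unfolding rd by (simp add: algebra_simps)
  also have "t * d = X * w t" using X by (simp add: w)
  also have "X * w t * (1 - w t) * (d - 1) = w t * (X * (1 - w t)) * (d - 1)" by (simp only: mult_ac)
  also have "\<dots> = - (w t * (d * ((1 - X * w t) * (1 - d))))"
    unfolding W'(1)[symmetric] by (simp add: algebra_simps)
  also have "\<dots> = - (w t * (d * (1 - X)))" unfolding W'(6) ..
  finally have "t * d' = d * (- (w t * (1 - X)) / q)" using q by (simp add: field_simps)
  then show th: "has_theta (atkin_delta x) (atkin_delta x t * (- (w t * (1 - X)) / q)) t"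
    using has_thetaI[OF d'] by (simp add: d_def)
  have "has_theta w ((t * d + t * (d * (- (w t * (1 - X)) / q))) / X) t"
    unfolding w_def d_def by (intro has_theta_cdivide has_theta_mult has_theta_ident th[unfolded w_def])
  moreover have "(t * d + t * (d * (- (w t * (1 - X)) / q))) / X = w t * (1 - w t) * (1 - X * w t) / q"
  proof -
    have "(t * d + t * (d * E)) / X = w t * (1 + E)" for E
      by (simp add: w add_divide_distrib distrib_left mult_ac)
    then have "(t * d + t * (d * (- (w t * (1 - X)) / q))) / X = w t * (1 + - (w t * (1 - X)) / q)" .
    also have "1 + - (w t * (1 - X)) / q = (q - w t * (1 - X)) / q"
      using q by (simp add: field_simps)
    also have "q - w t * (1 - X) = (1 - w t) * (1 - X * w t)"
      by (simp add: q_def power2_eq_square algebra_simps)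
    finally show ?thesis by simp
  qed
  ultimately show "has_theta w (w t * (1 - w t) * (1 - X * w t) / q) t" by simp
qed

text \<open>The factor of the highest term never vanishes. The value assumed for \<open>p 1\<close>
  is \<open>catalan 2 = 2\<close> times the explicit quadratic.\<close>

lemma catalan_atkin_unique:
  fixes x :: real and p :: "nat \<Rightarrow> complex"
  defines "a \<equiv> \<lambda>n. catalan (n + 1) * poly (scaled_atkin (n + 1)) x" and "X \<equiv> complex_of_real x"
  assumes rec: "\<And>n. (of_nat n + 1) * (of_nat n + 3) * (2 * of_nat n + 3) * ((of_nat n + 2) * (of_nat n + 4) * p (Suc (Suc n)))
     = (of_nat n + 1) * (of_nat n + 3) * (2 * of_nat n + 3) * ((of_nat n + 29/12) * (of_nat n + 37/12) - 2 * (of_nat n + 2) * (2 * of_nat n + 5) * (1 - X)) * p (Suc n)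
      - (2 * of_nat n + 5) * (of_nat n + 19/12) * (of_nat n + 11/12) * ((of_nat n + 17/12) * (of_nat n + 25/12) * p n - (of_nat n + 1) * (of_nat n + 3) * p (Suc n))"
    and p0: "p 0 = X - 5/12" and p1: "p 1 = 2 * X\<^sup>2 - 205/108 * X + 935/5184"
  shows "p n = complex_of_real (a n)"
proof -
  have "p n = complex_of_real (a n) \<and> p (Suc n) = complex_of_real (a (Suc n))"
  proof (induction n)
    case 0
    have "a 0 = x - 5/12" "a 1 = 2 * x\<^sup>2 - 205/108 * x + 935/5184"
      using catalan_1 catalan_2 by (simp_all add: a_def numeral_2_eq_2 power2_eq_square algebra_simps)
    then show ?case using p0 p1 by (simp add: X_def)
  next
    case (Suc n)
    let ?N = "of_nat n :: complex"
    let ?k = "(?N + 1) * (?N + 3) * (2 * ?N + 3) * ((?N + 2) * (?N + 4))"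
    have "?k * complex_of_real (a (Suc (Suc n)))
      = complex_of_real ((real n + 1) * (real n + 3) * (2 * real n + 3) * ((real n + 2) * (real n + 4) * a (Suc (Suc n))))"
      by (simp add: mult.assoc)
    also have "\<dots> = ?k * p (Suc (Suc n))"
      using arg_cong[OF catalan_atkin_recurrence[of n x], of complex_of_real] rec[of n] Suc
      by (simp add: X_def mult.assoc a_def del: scaled_atkin.simps)
    finally have "?k * complex_of_real (a (Suc (Suc n))) = ?k * p (Suc (Suc n))" .
    moreover have "?k \<noteq> 0"
    proof -
      have A: "?N + of_nat j \<noteq> 0" if "j > 0" for j using that by (metis add_is_0 not_gr_zero of_nat_add of_nat_eq_0_iff)
      moreover have "2 * ?N + 3 \<noteq> 0"
      proof -
        have "2 * ?N + 3 = of_nat (2 * n + 3)" by simp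
        then show ?thesis by (metis add_is_0 of_nat_eq_0_iff zero_neq_numeral)
      qed
      ultimately show ?thesis using A[of 1] A[of 2] A[of 3] A[of 4] by simp
    qed
    ultimately show ?case using Suc by simp
  qed
  then show ?thesis by simp
qed

lemma atkin_gf:
  fixes x :: real and t :: complex
  assumes x: "0 < x" "x < 1" and t: "norm t < 1"
  shows "(\<lambda>n. complex_of_real (catalan (n + 1) * poly (scaled_atkin (n + 1)) x) * t ^ n) sums
            (power_branch (17/12) (atkin_delta x) t
               / (complex_of_real (x powr (11/12))
                  * power_branch (1/2) (\<lambda>s. complex_of_real x - s * atkin_delta x s) t)
             * hyp2f1 (11/12) (19/12) 3 (t * atkin_delta x t / complex_of_real x)
             * (atkin_C x * hyp2f1 (- 7/12) (17/12) (1/3) (atkin_delta x t)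
                + atkin_D x * power_branch (2/3) (\<lambda>s. atkin_delta x s / complex_of_real x) t
                  * hyp2f1 (1/12) (25/12) (5/3) (atkin_delta x t)))"
proof -
  define X where "X = complex_of_real x"
  define \<delta> where "\<delta> = atkin_delta x"
  define w where "w = (\<lambda>s. s * \<delta> s / X)"
  have X: "X \<noteq> 0" "1 - X \<noteq> 0" using x by (auto simp: X_def)
  note \<delta> = atkin_delta_basic[OF x, folded \<delta>_def X_def]
  note W = atkin_w[OF x, folded \<delta>_def X_def]
  have \<delta>0: "\<delta> 0 = X" by (simp add: \<delta>_def atkin_delta_0 X_def)
  have \<delta>_less: "norm (\<delta> s) < 1" if "s \<in> ball 0 1" for s
    using norm_atkin_delta_less[OF x that] x by (simp add: \<delta>_def) (smt (verit) real_sqrt_lt_1_iff)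
  have w_hol: "w holomorphic_on ball 0 1" unfolding w_def by (intro holomorphic_intros \<delta>) (use X in auto)
  have w0: "w 0 = 0" by (simp add: w_def)
  have th: "has_theta \<delta> (\<delta> s * (- (w s * (1 - X)) / (1 - 2 * X * w s + X * (w s)\<^sup>2))) s"
    "has_theta w (w s * (1 - w s) * (1 - X * w s) / (1 - 2 * X * w s + X * (w s)\<^sup>2)) s"
    "1 - 2 * X * w s + X * (w s)\<^sup>2 \<noteq> 0" if "s \<in> ball 0 1" for s
    unfolding \<delta>_def X_def w_def by (rule atkin_theta_delta_w[OF x that])+
  obtain L1 where L1: "L1 holomorphic_on ball 0 1" "\<And>s. s \<in> ball 0 1 \<Longrightarrow> exp (L1 s) = \<delta> s" "L1 0 = complex_of_real (ln x)"
    by (rule holomorphic_log_ball[OF \<delta>(1) \<delta>(3), of x]) (use x \<delta>0 in \<open>auto simp: X_def\<close>)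
  have h2: "X - s * \<delta> s \<noteq> 0" if "s \<in> ball 0 1" for s using W(3,7)[OF that] X by simp
  obtain L2 where L2: "L2 holomorphic_on ball 0 1" "\<And>s. s \<in> ball 0 1 \<Longrightarrow> exp (L2 s) = X - s * \<delta> s" "L2 0 = complex_of_real (ln x)"
    by (rule holomorphic_log_ball[of "\<lambda>s. X - s * \<delta> s" x]) (use x \<delta>0 h2 in \<open>auto simp: X_def intro!: holomorphic_intros \<delta>(1)\<close>)
  obtain L3 where L3: "L3 holomorphic_on ball 0 1" "\<And>s. s \<in> ball 0 1 \<Longrightarrow> exp (L3 s) = \<delta> s / X" "L3 0 = complex_of_real (ln 1)"
    by (rule holomorphic_log_ball[of "\<lambda>s. \<delta> s / X" 1]) (use X \<delta>0 \<delta>(3) in \<open>auto intro!: holomorphic_intros \<delta>(1)\<close>)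
  define e where "e = (\<lambda>s. exp (complex_of_real (17/12) * L1 s) / (complex_of_real (x powr (11/12)) * exp (complex_of_real (1/2) * L2 s)))"
  define E where "E = (\<lambda>s. exp (complex_of_real (2/3) * L3 s))"
  define F where "F = hyp_fps (11/12) (19/12) 3"
  define G1 where "G1 = hyp_fps (- 7/12) (17/12) (1/3)"
  define G2 where "G2 = hyp_fps (1/12) (25/12) (5/3)"
  define f where "f = (\<lambda>s. eval_fps F (w s))"
  define f1 where "f1 = (\<lambda>s. eval_fps (fps_deriv F) (w s))"
  define C D where "C = atkin_C x" and "D = atkin_D x"
  define g where "g = (\<lambda>s. C * eval_fps G1 (\<delta> s) + D * (E s * eval_fps G2 (\<delta> s)))"
  \<comment> \<open>\<open>\<delta> d/d\<delta>\<close> applied to the bracket; the power 2/3 of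
    \<open>\<delta>\<close> contributes the summand with \<open>2/3\<close>.\<close>
  define g1 where "g1 = (\<lambda>s. C * (\<delta> s * eval_fps (fps_deriv G1) (\<delta> s))
      + D * (E s * (2/3 * eval_fps G2 (\<delta> s) + \<delta> s * eval_fps (fps_deriv G2) (\<delta> s))))"
  \<comment> \<open>On this neighbourhood of 0 the Gauss series at \<open>w\<close>
    converges.\<close>
  define U where "U = ball 0 1 \<inter> w -` ball 0 1"
  have UI: "s \<in> ball 0 1" "norm (w s) < 1" if "s \<in> U" for s using that by (auto simp: U_def)
  have e_th: "has_theta e (e s * (72 * w s * (1 - X * w s) - 204 * w s * (1 - X)) / (144 * (1 - 2 * X * w s + X * w s ^ 2))) s"
    if s: "s \<in> ball 0 1" for s
  proof -
    define q where "q = 1 - 2 * X * w s + X * w s ^ 2"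
    have q: "q \<noteq> 0" using th(3)[OF s] by (simp add: q_def)
    have nz: "\<delta> s \<noteq> 0" "1 - w s \<noteq> 0" using \<delta>(3)[OF s] W(3)[OF s] by (simp_all add: w_def)
    have "has_theta L1 (\<delta> s * (- (w s * (1 - X)) / q) / \<delta> s) s"
      by (rule has_theta_log[OF L1(1) open_ball s L1(2)]) (use th(1)[OF s] in \<open>simp_all add: q_def\<close>)
    then have t1: "has_theta L1 (- (w s * (1 - X)) / q) s" using nz by simp
    have Xd: "X - u * \<delta> u = X * (1 - w u)" for u using X by (simp add: w_def algebra_simps)
    have "has_theta (\<lambda>u. X * (1 - w u)) (X * (0 - w s * (1 - w s) * (1 - X * w s) / q)) s"
      unfolding q_def by (intro has_theta_cmult has_theta_diff has_theta_const th(2) s)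
    then have "has_theta L2 (X * (0 - w s * (1 - w s) * (1 - X * w s) / q) / (X * (1 - w s))) s"
      by (intro has_theta_log[OF L2(1) open_ball s]) (use L2(2) Xd in auto)
    moreover have "X * (0 - w s * (1 - w s) * (1 - X * w s) / q) / (X * (1 - w s)) = - (w s * (1 - X * w s) / q)"
      using nz X by simp
    ultimately have t2: "has_theta L2 (- (w s * (1 - X * w s) / q)) s" by simp
    have e_alt: "e = (\<lambda>u. exp (complex_of_real (17/12) * L1 u - complex_of_real (1/2) * L2 u) / complex_of_real (x powr (11/12)))"
      by (simp add: e_def exp_diff mult_ac)
    have "has_theta e (exp (complex_of_real (17/12) * L1 s - complex_of_real (1/2) * L2 s)
         * (complex_of_real (17/12) * (- (w s * (1 - X)) / q) - complex_of_real (1/2) * (- (w s * (1 - X * w s) / q))) / complex_of_real (x powr (11/12))) s"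
      unfolding e_alt by (intro has_theta_cdivide has_theta_chain[OF _ DERIV_exp] has_theta_diff has_theta_cmult t1 t2)
    then have "has_theta e (e s * (17/12 * (- (w s * (1 - X)) / q) + 1/2 * (w s * (1 - X * w s) / q))) s"
      unfolding e_alt by simp
    moreover have "17/12 * (- (w s * (1 - X)) / q) + 1/2 * (w s * (1 - X * w s) / q)
        = (72 * w s * (1 - X * w s) - 204 * w s * (1 - X)) / (144 * q)"
      using q by (simp add: divide_simps)
    ultimately show ?thesis unfolding q_def[symmetric] by simp
  qed
  have E_th: "has_theta E (2/3 * E s * (- (w s * (1 - X)) / (1 - 2 * X * w s + X * w s ^ 2))) s" if s: "s \<in> ball 0 1" for s
  proof -
    define q where "q = 1 - 2 * X * w s + X * w s ^ 2"
    have "has_theta L3 (\<delta> s * (- (w s * (1 - X)) / q) / X / (\<delta> s / X)) s"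
      unfolding q_def by (rule has_theta_log[OF L3(1) open_ball s L3(2) has_theta_cdivide[OF th(1)[OF s]]])
    then have "has_theta L3 (- (w s * (1 - X)) / q) s" using \<delta>(3)[OF s] X by simp
    then have "has_theta E (E s * (complex_of_real (2/3) * (- (w s * (1 - X)) / q))) s"
      unfolding E_def by (intro has_theta_chain[OF _ DERIV_exp] has_theta_cmult)
    then show ?thesis by (simp add: q_def mult_ac)
  qed
  interpret A: atkin_theta X U w e f f1 g g1
  proof
    show "open U" unfolding U_def
      by (intro continuous_open_preimage holomorphic_on_imp_continuous_on w_hol open_ball)
    show "0 \<in> U" by (simp add: U_def w0)
    fix s assume sU: "s \<in> U"
    note s = UI[OF sU]
    define q where "q = 1 - 2 * X * w s + X * w s ^ 2"
    have q: "q \<noteq> 0" using th(3)[OF s(1)] by (simp add: q_def)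
    have ws: "s * \<delta> s / X = w s" by (simp add: w_def)
    show "s * (1 - w s) = w s * (1 - X * w s)" "w s \<noteq> 1" using W(3,4)[OF s(1)] unfolding ws by auto
    show "1 - 2 * X * w s + X * (w s)\<^sup>2 \<noteq> 0" using q by (simp add: q_def)
    show "has_theta w (w s * (1 - w s) * (1 - X * w s) / (1 - 2 * X * w s + X * (w s)\<^sup>2)) s" by (rule th(2)[OF s(1)])
    show "has_theta e (e s * (72 * w s * (1 - X * w s) - 204 * w s * (1 - X)) / (144 * (1 - 2 * X * w s + X * (w s)\<^sup>2))) s"
      by (rule e_th[OF s(1)])
    note Fo = hyp_eval_ode[OF params_not_nonpos_Int(6,13,14) s(2), folded F_def]
    have w_th: "has_theta w (w s * (1 - w s) * (1 - X * w s) / q) s" unfolding q_def by (rule th(2)[OF s(1)])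
    show "has_theta f (f1 s * (w s * (1 - w s) * (1 - X * w s)) / (1 - 2 * X * w s + X * (w s)\<^sup>2)) s"
      using has_theta_chain[OF w_th Fo(2)] unfolding f_def f1_def q_def by simp
    have fa: "has_theta f1 (eval_fps (fps_deriv (fps_deriv F)) (w s) * (w s * (1 - w s) * (1 - X * w s) / q)) s"
      unfolding f1_def by (rule has_theta_chain[OF w_th Fo(3)])
    have fb: "144 * (eval_fps (fps_deriv (fps_deriv F)) (w s) * (w s * (1 - w s) * (1 - X * w s)))
       = (1 - X * w s) * (209 * f s - (432 - 504 * w s) * f1 s)"
    proof -
      have "w s * (1 - w s) * eval_fps (fps_deriv (fps_deriv F)) (w s) = 209/144 * f s - (3 - 7/2 * w s) * f1 s"
        using Fo(1) by (simp add: f_def f1_def)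
      then have "144 * (1 - X * w s) * (w s * (1 - w s) * eval_fps (fps_deriv (fps_deriv F)) (w s)) = 144 * (1 - X * w s) * (209/144 * f s - (3 - 7/2 * w s) * f1 s)"
        by simp
      then show ?thesis by (simp add: algebra_simps)
    qed
    show "has_theta f1 ((1 - X * w s) * (209 * f s - (432 - 504 * w s) * f1 s) / (144 * (1 - 2 * X * w s + X * (w s)\<^sup>2))) s"
      unfolding q_def[symmetric] fb[symmetric] by (rule has_theta_cong[OF fa]) simp
    define m where "m = - (w s * (1 - X)) / q"
    note d_th = th(1)[OF s(1), folded q_def, folded m_def]
    note E_th' = E_th[OF s(1), folded q_def, folded m_def]
    note Go = hyp_eval_ode[OF params_not_nonpos_Int(8,9,5) \<delta>_less[OF s(1)], folded G1_def]
    note Ho = hyp_eval_ode[OF params_not_nonpos_Int(10,11,12) \<delta>_less[OF s(1)], folded G2_def]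
    note G_th = has_theta_chain[OF d_th Go(2)] has_theta_chain[OF d_th Go(3)] has_theta_chain[OF d_th Ho(2)] has_theta_chain[OF d_th Ho(3)]
    define d a0 a1 a2 b0 b1 b2 where "d = \<delta> s" and "a0 = eval_fps G1 (\<delta> s)" and "a1 = eval_fps (fps_deriv G1) (\<delta> s)"
      and "a2 = eval_fps (fps_deriv (fps_deriv G1)) (\<delta> s)" and "b0 = eval_fps G2 (\<delta> s)" and "b1 = eval_fps (fps_deriv G2) (\<delta> s)"
      and "b2 = eval_fps (fps_deriv (fps_deriv G2)) (\<delta> s)"
    note abs_defs = d_def a0_def a1_def a2_def b0_def b1_def b2_def
    have "has_theta g (C * (a1 * (d * m)) + D * (2/3 * E s * m * b0 + E s * (b1 * (d * m)))) s"
      unfolding g_def abs_defs by (intro has_theta_add has_theta_cmult has_theta_mult E_th' G_th)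
    moreover have "C * (a1 * (d * m)) + D * (2/3 * E s * m * b0 + E s * (b1 * (d * m))) = m * g1 s"
      by (simp add: g1_def abs_defs algebra_simps)
    ultimately have "has_theta g (m * g1 s) s" by simp
    then show "has_theta g (- (w s * (1 - X) * g1 s) / (1 - 2 * X * w s + X * (w s)\<^sup>2)) s"
      by (simp add: m_def q_def)
    let ?T = "C * (d * m * a1 + d * (a2 * (d * m)))
        + D * (2/3 * E s * m * (2/3 * b0 + d * b1) + E s * (2/3 * (b1 * (d * m)) + (d * m * b1 + d * (b2 * (d * m)))))"
    have "has_theta g1 ?T s"
      unfolding g1_def abs_defs by (intro has_theta_add has_theta_cmult has_theta_mult d_th E_th' G_th)
    moreover have "?T = w s * (119 * X * (1 - w s) * g s + (48 * (1 - X * w s) - 264 * X * (1 - w s) - 144 * (1 - X)) * g1 s) / (144 * q)"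
    proof -
      have o1: "d * (1 - d) * a2 = - (119/144) * a0 - (1/3 - 11/6 * d) * a1"
        using Go(1) by (simp add: abs_defs)
      have o2: "d * (1 - d) * b2 = 25/144 * b0 - (5/3 - 19/6 * d) * b1"
        using Ho(1) by (simp add: abs_defs)
      have gs: "g s = C * a0 + D * (E s * b0)" "g1 s = C * (d * a1) + D * (E s * (2/3 * b0 + d * b1))"
        by (simp_all add: g_def g1_def abs_defs)
      have dX: "d * (1 - X * w s) = X * (1 - w s)" "(1 - X * w s) * (1 - d) = 1 - X" "1 - X * w s \<noteq> 0"
        using W(1,2,6)[OF s(1)] unfolding ws d_def by auto
      \<comment> \<open>The factor \<open>1 - d\<close> brings in the hypergeometric equations
        \<open>o1\<close> and \<open>o2\<close>; then \<open>(1 - X * w s) * (1 - d) = 1 - X\<close>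
        expresses the result in \<open>w s\<close>.\<close>
      have "(1 - d) * ?T = m * (C * ((1 - d) * (d * a1) + d * (d * (1 - d) * a2))
          + D * (E s * ((1 - d) * (4/9 * b0 + 7/3 * (d * b1)) + d * (d * (1 - d) * b2))))"
        by (simp add: algebra_simps)
      also have "\<dots> = m * ((1 - d) * g1 s - 119/144 * d * g s - (1/3 - 11/6 * d) * g1 s)"
        unfolding o1 o2 gs by (simp add: field_simps)
      finally have T: "(1 - d) * ?T = m * ((1 - d) * g1 s - 119/144 * d * g s - (1/3 - 11/6 * d) * g1 s)" .
      have "(1 - X) * ?T = (1 - X * w s) * ((1 - d) * ?T)" unfolding dX(2)[symmetric] by (simp only: mult.assoc)
      also have "\<dots> = m * (((1 - X * w s) * (1 - d)) * g1 s - 119/144 * (d * (1 - X * w s)) * g s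
           - (1/3 * (1 - X * w s) - 11/6 * (d * (1 - X * w s))) * g1 s)"
        unfolding T by (simp add: field_simps)
      also have "\<dots> = (1 - X) * (w s * (119 * X * (1 - w s) * g s + (48 * (1 - X * w s) - 264 * X * (1 - w s) - 144 * (1 - X)) * g1 s) / (144 * q))"
        unfolding dX m_def using q by (simp add: field_simps)
      finally show ?thesis using X(2) by (simp only: mult_cancel_left) simp
    qed
    ultimately show "has_theta g1 (w s * (119 * X * (1 - w s) * g s + (48 * (1 - X * w s) - 264 * X * (1 - w s) - 144 * (1 - X)) * g1 s)
                  / (144 * (1 - 2 * X * w s + X * (w s)\<^sup>2))) s"
      unfolding q_def[symmetric] by simp
  qed
  have of_real_L [simp]: "Im (L1 0) = 0" "Im (L2 0) = 0" "Im (L3 0) = 0"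
    using L1(3) L2(3) L3(3) by simp_all
  have e0: "e 0 = 1"
  proof -
    have "complex_of_real (x powr (11/12)) = exp (complex_of_real (11/12 * ln x))"
      unfolding exp_of_real using x by (simp add: powr_def)
    then have "complex_of_real (x powr (11/12)) * exp (complex_of_real (1/2) * L2 0) = exp (complex_of_real (11/12 * ln x) + complex_of_real (1/2 * ln x))"
      by (simp only: L2(3) exp_add of_real_mult)
    also have "\<dots> = exp (complex_of_real (17/12) * L1 0)" by (simp add: L1(3) algebra_simps)
    finally show ?thesis by (simp add: e_def)
  qed
  have E0: "E 0 = 1" by (simp add: E_def L3(3))
  have f0: "f 0 = 1" by (simp add: f_def w0 eval_fps_at_0 F_def)
  note CD = atkin_CD_eval[OF x, folded X_def G1_def G2_def C_def D_def]
  have g0: "g 0 = X - 5/12" using CD(1) by (simp add: g_def \<delta>0 E0)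
  have g10: "(1 - X) * g1 0 = X * (7/8 - 7/12 * X)" using CD(2) by (simp add: g1_def \<delta>0 E0)
  define p where "p = fps_expansion A.B0 0"
  define r where "r = fps_expansion A.Q 0"
  note rec = A.coeff_recurrences[folded p_def r_def]
  have p0: "p $ 0 = X - 5/12"
    using has_fps_expansion_imp_0_eq_fps_nth_0[OF rec(1)] by (simp add: A.B0_def e0 f0 g0)
  \<comment> \<open>At \<open>t = 0\<close> one has \<open>w = 0\<close> and \<open>q = 1\<close>,
    so \<open>Q\<close> is \<open>17/12 B0 + B2\<close>.\<close>
  have r0: "r $ 0 = 17/12 * (X - 5/12) + g1 0"
    unfolding has_fps_expansion_imp_0_eq_fps_nth_0[OF rec(2), symmetric]
    by (simp add: A.Q_def A.LQ_def A.B0_def A.B2_def A.q_def w0 e0 f0 g0 add_divide_distrib)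
  \<comment> \<open>\<open>g1 0\<close> enters only with the factor \<open>1 - X\<close>, just as
    the second Legendre-type relation supplies it.\<close>
  have "3 * p $ 1 = 425/144 * (X - 5/12) - 3 * ((1 - X) * (17/12 * (X - 5/12)) + (1 - X) * g1 0)"
    using rec(3)[of 0] by (simp add: p0 r0 algebra_simps)
  also have "\<dots> = 3 * (2 * X\<^sup>2 - 205/108 * X + 935/5184)"
    unfolding g10 by (simp add: power2_eq_square field_simps)
  finally have p1: "p $ 1 = 2 * X\<^sup>2 - 205/108 * X + 935/5184"
    by (simp only: mult_cancel_left) simp
  have coeffs: "p $ n = complex_of_real (catalan (n + 1) * poly (scaled_atkin (n + 1)) x)" for n
    by (rule catalan_atkin_unique[OF _ p0[unfolded X_def] p1[unfolded X_def]])
       (use A.three_term_recurrence[folded p_def] in \<open>simp only: X_def\<close>)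
  obtain \<phi> where \<phi>: "\<phi> holomorphic_on cut_plane"
    "\<And>y. norm y < 1 \<Longrightarrow> \<phi> y = hyp2f1_series (11/12) (complex_of_real (19/12)) (complex_of_real 3) y"
    \<comment> \<open>Euler's integral is taken with \<open>b = 19/12\<close>, since
      \<open>b > 1\<close> excludes 11/12; then \<open>c - b = 17/12\<close>.\<close>
    using hyp2f1_continuation[of "19/12" 3 "11/12"] by auto
  have \<phi>_eq: "hyp2f1 (11/12) (19/12) 3 y = \<phi> y" if "y \<in> cut_plane" for y
    by (rule hyp2f1_eq_continuation[OF \<phi>(1) _ that]) (use \<phi>(2) in simp)
  \<comment> \<open>\<open>K\<close> agrees with \<open>A.B0\<close> on \<open>U\<close> but is
    holomorphic on the whole disc, so the expansion \<open>p\<close> of \<open>A.B0\<close> sums to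
    \<open>K\<close> there.\<close>
  define K where "K = (\<lambda>s. e s * \<phi> (w s) * g s)"
  have w_cut: "w s \<in> cut_plane" if "s \<in> ball 0 1" for s using W(8)[OF that] by (simp add: w_def)
  have eval_hol: "(\<lambda>s. eval_fps (hyp_fps a b c) (\<delta> s)) holomorphic_on ball 0 1"
    if "a \<notin> \<int>\<^sub>\<le>\<^sub>0" "b \<notin> \<int>\<^sub>\<le>\<^sub>0" "c \<notin> \<int>\<^sub>\<le>\<^sub>0" for a b c
  proof -
    have "eval_fps (hyp_fps a b c) holomorphic_on ball 0 1"
      by (rule holomorphic_on_eval_fps) (simp add: hyp_fps_conv_radius[OF that] eball_def ball_def subset_iff)
    moreover have "\<delta> ` ball 0 1 \<subseteq> ball 0 1" using \<delta>_less by auto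
    ultimately show ?thesis using holomorphic_on_compose_gen[OF \<delta>(1)] by (simp add: o_def)
  qed
  have "K holomorphic_on ball 0 1"
  proof -
    have "(\<lambda>s. \<phi> (w s)) holomorphic_on ball 0 1"
      using holomorphic_on_compose_gen[OF w_hol \<phi>(1) image_subsetI[OF w_cut]] by (simp add: o_def)
    moreover have "e holomorphic_on ball 0 1"
      unfolding e_def by (intro holomorphic_intros L1 L2) (use x in auto)
    moreover have "g holomorphic_on ball 0 1"
      unfolding g_def E_def G1_def G2_def by (intro holomorphic_intros L3 eval_hol params_not_nonpos_Int)
    ultimately show ?thesis unfolding K_def by (intro holomorphic_intros)
  qed
  moreover have "K has_fps_expansion p"
  proof (rule has_fps_expansion_transform_on_open[OF A.open_U A.zero_U rec(1)])
    fix s assume s: "s \<in> U"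
    have "f s = \<phi> (w s)"
      using UI(2)[OF s] \<phi>_eq[OF w_cut[OF UI(1)[OF s]]] by (simp add: f_def F_def hyp2f1_eq_eval_fps)
    then show "A.B0 s = K s" by (simp add: A.B0_def K_def)
  qed
  ultimately have "(\<lambda>n. p $ n * t ^ n) sums K t"
    using t by (intro has_fps_expansion_imp_sums_complex[of K p 1]) (auto simp: eball_def ball_def one_ereal_def)
  moreover have "K t = power_branch (17/12) (atkin_delta x) t
               / (complex_of_real (x powr (11/12))
                  * power_branch (1/2) (\<lambda>s. complex_of_real x - s * atkin_delta x s) t)
             * hyp2f1 (11/12) (19/12) 3 (t * atkin_delta x t / complex_of_real x)
             * (atkin_C x * hyp2f1 (- 7/12) (17/12) (1/3) (atkin_delta x t)
                + atkin_D x * power_branch (2/3) (\<lambda>s. atkin_delta x s / complex_of_real x) t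
                  * hyp2f1 (1/12) (25/12) (5/3) (atkin_delta x t))"
  proof -
    have tb: "t \<in> ball 0 1" using t by simp
    have "power_branch (17/12) \<delta> t = exp (complex_of_real (17/12) * L1 t)"
      by (rule power_branch_eqI[OF L1(1,2)]) (use tb in auto)
    moreover have "power_branch (1/2) (\<lambda>s. X - s * \<delta> s) t = exp (complex_of_real (1/2) * L2 t)"
      by (rule power_branch_eqI[OF L2(1,2)]) (use tb in auto)
    moreover have "power_branch (2/3) (\<lambda>s. \<delta> s / X) t = E t"
      unfolding E_def by (rule power_branch_eqI[OF L3(1,2)]) (use tb in auto)
    moreover have "hyp2f1 (11/12) (19/12) 3 (t * \<delta> t / X) = \<phi> (w t)"
      using \<phi>_eq[OF w_cut[OF tb]] by (simp add: w_def)
    ultimately show ?thesis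
      unfolding \<delta>_def[symmetric] X_def[symmetric]
      by (simp only: K_def e_def g_def C_def D_def G1_def G2_def hyp2f1_eq_eval_fps[OF \<delta>_less[OF tb]] mult.assoc)
  qed
  ultimately show ?thesis by (simp add: coeffs)
qed

theorem theorem6p4:
  shows "(\<forall>(x::real) (t::complex). 0 < x \<and> x < 1 \<and> norm t < 1 \<longrightarrow>
            (\<lambda>n. complex_of_real (catalan (n + 1) * poly (scaled_atkin (n + 1)) x) * t ^ n) sums
            (power_branch (17/12) (atkin_delta x) t
               / (complex_of_real (x powr (11/12))
                  * power_branch (1/2) (\<lambda>s. complex_of_real x - s * atkin_delta x s) t)
             * hyp2f1 (11/12) (19/12) 3 (t * atkin_delta x t / complex_of_real x)
             * (atkin_C x * hyp2f1 (- 7/12) (17/12) (1/3) (atkin_delta x t)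
                + atkin_D x * power_branch (2/3) (\<lambda>s. atkin_delta x s / complex_of_real x) t
                  * hyp2f1 (1/12) (25/12) (5/3) (atkin_delta x t))))
       \<and> (\<forall>t::complex. norm t < 1 \<longrightarrow>
            (\<lambda>n. complex_of_real (catalan (n + 1) * poly (scaled_atkin (n + 1)) 0) * (- t) ^ n) sums
            (- (5/12) * hyp2f1 (11/12) (17/12) 3 t))
       \<and> (\<forall>n::nat. poly (scaled_atkin (n + 1)) 0 =
            (- 1) ^ n * (- (5/12)) * (pochhammer (11/12) n * pochhammer (17/12) n / fact (2 * n + 1)))"
  using atkin_gf atkin_gf_at_0 poly_scaled_atkin_0 by blast

end
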